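(* Assume $V$ satisfies (U), and let $\bar v<1$, $c_0$, $s_0$, $\bar\delta$, the modified coefficients and the center manifolds $\mathcal I_\varepsilon=\{(r,u,h_\varepsilon(r,u))\}$, $\varepsilon\in(0,\varepsilon_0]$, be as in the context. Then there exists $\varepsilon_1>0$, depending only on $\bar v$, such that for every $\varepsilon\in(0,\varepsilon_1]$, every solution of the effective equation starting at a point $(r,u,h_\varepsilon(r,u))\in\mathcal I_\varepsilon$ with $|u|\le\bar v$ never reaches the set $\{(r,u,h_\varepsilon(r,u)):|u|=1-\bar\delta\}$ for any future time. In particular such solutions exist globally forward in time.
   Context: $V\in C^3(\mathbb{R}^3)$ with (U): $\inf V>-\infty$, $\sup(|V|+|\nabla V|+|\nabla^2V|+|\nabla^3V|)<\infty$. $\rho\in C_0^\infty$ radial, $\mathsf e=\int\rho\neq0$, $\hat\rho(k)=(2\pi)^{-3/2}\int\rho e^{-ik\cdot x}$. For $|u|<1$: $\gamma=(1-|u|^2)^{-1/2}$, $m_0(u)w=\gamma w+\gamma^3(u\cdot w)u$, $m_e=\frac13\int|\hat\rho|^2|k|^{-2}dk$, $\varphi(s)=\frac{1}{2s^2(1-s^2)}-\frac{1}{4s^3}\log\frac{1+s}{1-s}$, $m_f(u)w=3m_e(\varphi(|u|)w+|u|^{-1}\varphi'(|u|)(u\cdot w)u)$, $m=m_0+m_f$, $a(u)w=\frac{\mathsf e^2}{12\pi}[\gamma^4w+4\gamma^6(u\cdot w)u]$, $b(u,w)=\frac{\mathsf e^2}{4\pi}[2\gamma^6(u\cdot w)w+\gamma^6|w|^2u+6\gamma^8(u\cdot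 w)^2u]$, $\mathcal E_s(u)=\gamma-1+3m_e[\frac{2-|u|^2}{2(1-|u|^2)}-\frac{1}{2|u|}\log\frac{1+|u|}{1-|u|}]$, $H(r,u)=\mathcal E_s(u)+V(r)$. Effective equation: $\dot r=u$, $m(u)\dot u=-\nabla V(r)+\varepsilon a(u)\ddot u+\varepsilon b(u,\dot u)$. Given $\bar v<1$, choose $c_0\in\mathbb{R}$ with $\{(r,u):|u|\le\bar v\}\subset\{H\le c_0\}$, put $s_0=\sup\{|u|:H(r,u)\le c_0+1\text{ for some }r\}<1$ and $\bar\delta=\min\{(1-\bar v)/2,(1-s_0)/2\}$. Modify $a,m,b$ on $1-\bar\delta<|u|<1$ by continuing them with their values at $|u|=1-\bar\delta$ (i.e. replacing $u$ by $(1-\bar\delta)u/|u|$). With $x=(r,u)$, $y=\dot u$ the (modified) effective equation is $\dot x=(u,y)$, $\varepsilon\dot y=a(u)^{-1}[m(u)y+\nabla V(r)-\varepsilon b(u,y)]$; the manifold $\{m(u)y=-\nabla V(r)\}$ is invariant for $\varepsilon=0$ and normally repulsive. Geometric singular perturbation theory provides $\varepsilon_0=\varepsilon_0(\bar\delta)>0$ and $C^1$ functions $h_\varepsilon:\mathbb{R}^3\times\{|u|<1\}\to\mathbb{R}^3$, $\varepsilon\in(0,\varepsilon_0]$, with $\sup|h_\varepsilon|\le c(\bar\delta)$ uniformly in $\varepsilon$, such that $\mathcal I_\varepsilon=\{(r,u,h_\varepsilon(r,u))\}$ is forward invariant for the modified system; while $|u|<1-\bar\delta$ the modified system coincides with the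 effective equation. *)

theory Defs
  imports "HOL-Analysis.Analysis"
begin

type_synonym vec3 = "real^3"

definition dderiv :: "('a::real_normed_vector) list \<Rightarrow> ('a \<Rightarrow> real) \<Rightarrow> 'a \<Rightarrow> real" where
  "dderiv vs f = foldr (\<lambda>v g x. frechet_derivative g (at x) v) vs f"

definition Ck_fun :: "nat \<Rightarrow> ('a::real_normed_vector \<Rightarrow> real) \<Rightarrow> bool" where
  "Ck_fun k f \<longleftrightarrow>
     (\<forall>vs. length vs < k \<longrightarrow> (\<forall>x. dderiv vs f differentiable (at x))) \<and>
     (\<forall>vs. length vs = k \<longrightarrow> continuous_on UNIV (dderiv vs f))"

definition smooth_fun :: "('a::real_normed_vector \<Rightarrow> real) \<Rightarrow> bool" where
  "smooth_fun f \<longleftrightarrow> (\<forall>vs. \<forall>x. dderiv vs f differentiable (at x))"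

definition grad :: "(vec3 \<Rightarrow> real) \<Rightarrow> vec3 \<Rightarrow> vec3" where
  "grad f x = (\<chi> i. frechet_derivative f (at x) (axis i 1))"

text \<open>Assumption (U): V bounded below, V and its derivatives up to order 3 bounded
  (|nabla^k V| bounded is expressed via iterated directional derivatives along unit vectors).\<close>
definition cond_U :: "(vec3 \<Rightarrow> real) \<Rightarrow> bool" where
  "cond_U V \<longleftrightarrow> Ck_fun 3 V \<and> bdd_below (range V) \<and>
     (\<exists>B. \<forall>vs x. length vs \<le> 3 \<and> (\<forall>v\<in>set vs. norm v = 1) \<longrightarrow> \<bar>dderiv vs V x\<bar> \<le> B)"

definition admissible_rho :: "(vec3 \<Rightarrow> real) \<Rightarrow> bool" where
  "admissible_rho \<rho> \<longleftrightarrow> smooth_fun \<rho> \<and> compact (closure {x. \<rho> x \<noteq> 0}) \<and>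
     (\<forall>x y. norm x = norm y \<longrightarrow> \<rho> x = \<rho> y)"

definition charge :: "(vec3 \<Rightarrow> real) \<Rightarrow> real" where
  "charge \<rho> = integral UNIV \<rho>"

definition rho_hat :: "(vec3 \<Rightarrow> real) \<Rightarrow> vec3 \<Rightarrow> complex" where
  "rho_hat \<rho> k = complex_of_real ((2*pi) powr (-3/2)) *
      integral UNIV (\<lambda>x. complex_of_real (\<rho> x) * cis (- (k \<bullet> x)))"

definition m_e :: "(vec3 \<Rightarrow> real) \<Rightarrow> real" where
  "m_e \<rho> = (1/3) * integral UNIV (\<lambda>k. (cmod (rho_hat \<rho> k))\<^sup>2 / (norm k)\<^sup>2)"

definition lorentz :: "vec3 \<Rightarrow> real" where
  "lorentz u = 1 / sqrt (1 - (norm u)\<^sup>2)"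

text \<open>phi is extended continuously to s = 0 (phi(0) = 1/3).\<close>
definition phi :: "real \<Rightarrow> real" where
  "phi s = (if s = 0 then 1/3 else
     1 / (2 * s\<^sup>2 * (1 - s\<^sup>2)) - 1 / (4 * s^3) * ln ((1 + s) / (1 - s)))"

definition m0 :: "vec3 \<Rightarrow> vec3 \<Rightarrow> vec3" where
  "m0 u w = lorentz u *\<^sub>R w + ((lorentz u)^3 * (u \<bullet> w)) *\<^sub>R u"

definition mf :: "(vec3 \<Rightarrow> real) \<Rightarrow> vec3 \<Rightarrow> vec3 \<Rightarrow> vec3" where
  "mf \<rho> u w = (3 * m_e \<rho>) *\<^sub>R (phi (norm u) *\<^sub>R w
       + (inverse (norm u) * deriv phi (norm u) * (u \<bullet> w)) *\<^sub>R u)"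

definition mass :: "(vec3 \<Rightarrow> real) \<Rightarrow> vec3 \<Rightarrow> vec3 \<Rightarrow> vec3" where
  "mass \<rho> u w = m0 u w + mf \<rho> u w"

definition acoef :: "(vec3 \<Rightarrow> real) \<Rightarrow> vec3 \<Rightarrow> vec3 \<Rightarrow> vec3" where
  "acoef \<rho> u w = ((charge \<rho>)\<^sup>2 / (12 * pi)) *\<^sub>R
      ((lorentz u)^4 *\<^sub>R w + (4 * (lorentz u)^6 * (u \<bullet> w)) *\<^sub>R u)"

definition bcoef :: "(vec3 \<Rightarrow> real) \<Rightarrow> vec3 \<Rightarrow> vec3 \<Rightarrow> vec3" where
  "bcoef \<rho> u w = ((charge \<rho>)\<^sup>2 / (4 * pi)) *\<^sub>R
      ((2 * (lorentz u)^6 * (u \<bullet> w)) *\<^sub>R w + ((lorentz u)^6 * (norm w)\<^sup>2) *\<^sub>R u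
       + (6 * (lorentz u)^8 * (u \<bullet> w)\<^sup>2) *\<^sub>R u)"

text \<open>E_s, extended continuously to u = 0 (value 0).\<close>
definition Es :: "(vec3 \<Rightarrow> real) \<Rightarrow> vec3 \<Rightarrow> real" where
  "Es \<rho> u = (if u = 0 then 0 else
     lorentz u - 1 + 3 * m_e \<rho> * ((2 - (norm u)\<^sup>2) / (2 * (1 - (norm u)\<^sup>2))
        - 1 / (2 * norm u) * ln ((1 + norm u) / (1 - norm u))))"

definition Ham :: "(vec3 \<Rightarrow> real) \<Rightarrow> (vec3 \<Rightarrow> real) \<Rightarrow> vec3 \<Rightarrow> vec3 \<Rightarrow> real" where
  "Ham \<rho> V r u = Es \<rho> u + V r"

definition s0 :: "(vec3 \<Rightarrow> real) \<Rightarrow> (vec3 \<Rightarrow> real) \<Rightarrow> real \<Rightarrow> real" where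
  "s0 \<rho> V c0 = Sup {norm u | u r. norm u < 1 \<and> Ham \<rho> V r u \<le> c0 + 1}"

definition delta_bar :: "(vec3 \<Rightarrow> real) \<Rightarrow> (vec3 \<Rightarrow> real) \<Rightarrow> real \<Rightarrow> real \<Rightarrow> real" where
  "delta_bar \<rho> V vbar c0 = min ((1 - vbar) / 2) ((1 - s0 \<rho> V c0) / 2)"

definition cutoff :: "real \<Rightarrow> vec3 \<Rightarrow> vec3" where
  "cutoff \<delta> u = (if norm u \<le> 1 - \<delta> then u else ((1 - \<delta>) / norm u) *\<^sub>R u)"

definition is_solution ::
  "(vec3 \<Rightarrow> vec3 \<Rightarrow> vec3) \<Rightarrow> (vec3 \<Rightarrow> vec3 \<Rightarrow> vec3) \<Rightarrow> (vec3 \<Rightarrow> vec3 \<Rightarrow> vec3) \<Rightarrow>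
   (vec3 \<Rightarrow> real) \<Rightarrow> real \<Rightarrow> real set \<Rightarrow>
   (real \<Rightarrow> vec3) \<Rightarrow> (real \<Rightarrow> vec3) \<Rightarrow> (real \<Rightarrow> vec3) \<Rightarrow> bool" where
  "is_solution M A B V \<epsilon> I r u y \<longleftrightarrow>
     (\<forall>t\<in>I. norm (u t) < 1 \<and>
        (r has_vector_derivative u t) (at t within I) \<and>
        (u has_vector_derivative y t) (at t within I) \<and>
        (\<exists>z. (y has_vector_derivative z) (at t within I) \<and>
             M (u t) (y t) = - grad V (r t) + \<epsilon> *\<^sub>R A (u t) z + \<epsilon> *\<^sub>R B (u t) (y t)))"

definition effective_solution where
  "effective_solution \<rho> V = is_solution (mass \<rho>) (acoef \<rho>) (bcoef \<rho>) V"

definition modified_solution where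
  "modified_solution \<rho> V \<delta> =
     is_solution (\<lambda>u. mass \<rho> (cutoff \<delta> u)) (\<lambda>u. acoef \<rho> (cutoff \<delta> u))
                 (\<lambda>u. bcoef \<rho> (cutoff \<delta> u)) V"

definition C1_on :: "('a::euclidean_space \<Rightarrow> 'b::euclidean_space) \<Rightarrow> 'a set \<Rightarrow> bool" where
  "C1_on f S \<longleftrightarrow> (\<exists>D. (\<forall>x\<in>S. (f has_derivative blinfun_apply (D x)) (at x)) \<and> continuous_on S D)"

end

(* The Schott-corrected energy H(r,u) - eps kappa g(|u|^2) (u . y), with kappa = e^2/(12 pi) and
   g(s) = (1-s)^-2 + 4 s (1-s)^-3, is nonincreasing along solutions of the effective equation.
   As long as the solution stays on the center manifold, |y| <= C, so the correction is O(eps)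
   uniformly in time and H <= c0 + 1 for small eps; by the choice of s0 this forces
   |u| <= s0 < 1 - delta, and a continuation argument shows that |u| = 1 - delta is never reached.
   For global existence, solve the full second-order system globally after truncating u and y
   (Picard iteration); forward invariance of the manifold and the same confinement show that the
   truncation is never active. *)

theory Submission
  imports Defs
begin

section \<open>Mass and energy as functions of the squared velocity\<close>

text \<open>At first sight the argument is circular: the energy bound needs |y| \<le> C, this holds
  only on the manifold, invariance of the manifold is known only for the modified system, and that
  system agrees with the effective equation only while |u| \<le> 1 - delta. The circle opens because
  the strict bound |u| < 1 - delta on a half-open time interval returns the smaller radius
  \<open>s0\<close>, and the gap between the two absorbs the passage to the right end point. H
  itself has a rate without a sign, since u . a(u)y' has none; the Schott term is chosen so that
  only minus the radiated power remains. The 1 in \<open>c0 + 1\<close> is the budget for its values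
  at times 0 and t, at most 1/2 each. The closed formulas for phi and E_s are singular at u = 0
  although the functions are not, and global existence needs Lipschitz coefficients there. Expanding
  the geometric series and the logarithm in phi gives the coefficients (1 - 1/(2k+3))/2 =
  (k+1)/(2k+3) of s^(2k); all later calculus is done in x = u . u with this series.\<close>

text \<open>Power series in \<open>x = s\<^sup>2\<close>: it shows that \<open>phi s\<close> and \<open>phi' s / s\<close> are smooth functions of
  \<open>u \<bullet> u\<close>, also at \<open>u = 0\<close>.\<close>

definition phi_coeff :: "nat \<Rightarrow> real" where
  "phi_coeff k = (real k + 1) / (2 * real k + 3)"

definition phi_series :: "real \<Rightarrow> real" where
  "phi_series x = (\<Sum>k. phi_coeff k * x ^ k)"

definition phi_series' :: "real \<Rightarrow> real" where
  "phi_series' x = (\<Sum>k. diffs phi_coeff k * x ^ k)"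

definition phi_series'' :: "real \<Rightarrow> real" where
  "phi_series'' x = (\<Sum>k. diffs (diffs phi_coeff) k * x ^ k)"

lemma summable_phi_series:
  assumes "\<bar>x\<bar> < 1"
  shows "summable (\<lambda>k. phi_coeff k * x ^ k)"
proof (rule summable_comparison_test')
  show "summable (\<lambda>k. \<bar>x\<bar> ^ k)"
    using assms by (intro summable_geometric) auto
  show "norm (phi_coeff k * x ^ k) \<le> \<bar>x\<bar> ^ k" if "k \<ge> 0" for k
  proof -
    have "\<bar>phi_coeff k\<bar> \<le> 1"
      by (simp add: phi_coeff_def field_simps)
    then show ?thesis
      by (simp add: abs_mult power_abs mult_left_le_one_le)
  qed
qed

lemma summable_phi_series':
  assumes "\<bar>x\<bar> < 1"
  shows "summable (\<lambda>k. diffs phi_coeff k * x ^ k)"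
  using assms by (intro termdiff_converges[where K = 1] summable_phi_series) auto

lemma phi_series_deriv:
  assumes "\<bar>x\<bar> < 1"
  shows "(phi_series has_real_derivative phi_series' x) (at x)"
  unfolding phi_series_def phi_series'_def
  using assms by (intro termdiffs_strong'[where K = 1] summable_phi_series) auto

lemma phi_series'_deriv:
  assumes "\<bar>x\<bar> < 1"
  shows "(phi_series' has_real_derivative phi_series'' x) (at x)"
  unfolding phi_series'_def phi_series''_def
  using assms by (intro termdiffs_strong'[where K = 1] summable_phi_series') auto

lemma isCont_phi_series'':
  assumes "\<bar>x\<bar> < 1"
  shows "isCont phi_series'' x"
proof -
  have "summable (\<lambda>k. diffs (diffs phi_coeff) k * y ^ k)" if "norm y < 1" for y :: real
    using that by (intro termdiff_converges[where K = 1] summable_phi_series') auto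
  then have "((\<lambda>x. \<Sum>k. diffs (diffs phi_coeff) k * x ^ k) has_field_derivative
               (\<Sum>k. diffs (diffs (diffs phi_coeff)) k * x ^ k)) (at x)"
    using assms by (intro termdiffs_strong'[where K = 1]) auto
  then show ?thesis
    unfolding phi_series''_def[abs_def] by (rule DERIV_isCont)
qed

text \<open>Coefficientwise this is (2n+3) \<open>phi_coeff n\<close> = n+1, together with the
  series of (n+1) x^n. It later removes the rational term from the derivative of the kinetic
  energy.\<close>

lemma phi_series_ode:
  assumes "\<bar>x\<bar> < 1"
  shows "3 * phi_series x + 2 * x * phi_series' x = 1 / (1 - x)\<^sup>2"
proof -
  have "(\<lambda>n. of_nat n * phi_coeff n * x ^ (n - Suc 0)) sums phi_series' x"
    unfolding phi_series'_def by (rule diffs_equiv[OF summable_phi_series'[OF assms]])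
  then have 1: "(\<lambda>n. 2 * x * (of_nat n * phi_coeff n * x ^ (n - Suc 0))) sums (2 * x * phi_series' x)"
    by (rule sums_mult)
  have 2: "(\<lambda>n. 3 * (phi_coeff n * x ^ n)) sums (3 * phi_series x)"
    unfolding phi_series_def by (intro sums_mult summable_sums summable_phi_series assms)
  have "3 * (phi_coeff n * x ^ n) + 2 * x * (of_nat n * phi_coeff n * x ^ (n - Suc 0))
      = of_nat (Suc n) * x ^ n" for n
  proof -
    \<comment> \<open>The case n = 0 is separate because of the exponent \<open>n - Suc 0\<close>;
      there the factor n vanishes.\<close>
    have "2 * x * (of_nat n * phi_coeff n * x ^ (n - Suc 0)) = 2 * n * phi_coeff n * x ^ n"
      by (cases n) auto
    moreover have "(2 * real n + 3) * phi_coeff n = real n + 1"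
      by (simp add: phi_coeff_def)
    moreover have "3 * (phi_coeff n * x ^ n) + 2 * n * phi_coeff n * x ^ n
        = ((2 * real n + 3) * phi_coeff n) * x ^ n"
      by (simp add: algebra_simps)
    ultimately show ?thesis
      by (simp only: of_nat_Suc add.commute[of 1])
  qed
  with sums_add[OF 2 1] have "(\<lambda>n. of_nat (Suc n) * x ^ n) sums (3 * phi_series x + 2 * x * phi_series' x)"
    by simp
  moreover have "(\<lambda>n. of_nat (Suc n) * x ^ n) sums (1 / (1 - x)\<^sup>2)"
    using assms by (intro geometric_deriv_sums) auto
  ultimately show ?thesis
    by (rule sums_unique2)
qed

text \<open>Every coefficient is at least \<open>phi_coeff 0\<close> = 1/3, so the series dominates
  a geometric one.\<close>

lemma phi_series_lower:
  assumes "0 \<le> x" "x < 1"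
  shows "1 / (3 * (1 - x)) \<le> phi_series x"
proof -
  have 1: "(\<lambda>k. 1/3 * x ^ k) sums (1/3 * (1 / (1 - x)))"
    using assms by (intro sums_mult geometric_sums) auto
  have 2: "(\<lambda>k. phi_coeff k * x ^ k) sums phi_series x"
    unfolding phi_series_def using assms by (intro summable_sums summable_phi_series) auto
  have "1/3 * x ^ k \<le> phi_coeff k * x ^ k" for k
    using assms by (intro mult_right_mono) (auto simp: phi_coeff_def field_simps)
  from sums_le[OF this 1 2] have "1/3 * (1 / (1 - x)) \<le> phi_series x" .
  then show ?thesis by simp
qed

text \<open>Since 1 - 2 \<open>phi_coeff k\<close> = 1/(2k+3), a geometric series minus twice the
  phi series produces the odd reciprocals of the logarithmic series. This eliminates the logarithm
  from both phi and \<open>Es\<close>.\<close>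

lemma ln_eq_phi_series:
  assumes "0 < s" "s < 1"
  shows "ln ((1 + s) / (1 - s)) = 2 * s * (1 / (1 - s\<^sup>2) - 2 * s\<^sup>2 * phi_series (s\<^sup>2))"
proof -
  have s2: "\<bar>s\<^sup>2\<bar> < 1"
    using assms by (simp add: power_less_one_iff abs_square_less_1)
  define x where "x = (1 + s) / (1 - s)"
  have "x > 0" and xs: "(x - 1) / (x + 1) = s"
    using assms by (auto simp: x_def field_simps)
  have "(\<lambda>n. 2 * s ^ (2*n+1) / of_nat (2*n+1)) sums ln x"
    using ln_series_quadratic[OF \<open>x > 0\<close>] unfolding xs by simp
  moreover have "(\<lambda>n. 2 * s ^ (2*n+1) / of_nat (2*n+1)) sums (2 * s * (1 / (1 - s\<^sup>2) - 2 * s\<^sup>2 * phi_series (s\<^sup>2)))"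
  proof -
    \<comment> \<open>Only the terms from index 1 on are matched here; the 1 removed from the
      geometric sum corresponds to the term 2s of index 0, added back below.\<close>
    have "(\<lambda>k. (s\<^sup>2) ^ Suc k - 2 * s\<^sup>2 * (phi_coeff k * (s\<^sup>2) ^ k)) sums
            ((1 / (1 - s\<^sup>2) - 1) - 2 * s\<^sup>2 * phi_series (s\<^sup>2))"
      unfolding phi_series_def
      using geometric_sums[of "s\<^sup>2"] s2
      by (intro sums_diff sums_mult summable_sums summable_phi_series, subst sums_Suc_iff) auto
    then have "(\<lambda>k. 2 * s * ((s\<^sup>2) ^ Suc k - 2 * s\<^sup>2 * (phi_coeff k * (s\<^sup>2) ^ k))) sums
            (2 * s * ((1 / (1 - s\<^sup>2) - 1) - 2 * s\<^sup>2 * phi_series (s\<^sup>2)))"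
      by (rule sums_mult)
    moreover have "2 * s * ((s\<^sup>2) ^ Suc k - 2 * s\<^sup>2 * (phi_coeff k * (s\<^sup>2) ^ k))
        = 2 * s ^ (2 * Suc k + 1) / of_nat (2 * Suc k + 1)" for k
    proof -
      have "1 - 2 * phi_coeff k = 1 / of_nat (2 * Suc k + 1)"
        by (simp add: phi_coeff_def field_simps)
      moreover have "2 * s * ((s\<^sup>2) ^ Suc k - 2 * s\<^sup>2 * (phi_coeff k * (s\<^sup>2) ^ k))
          = 2 * s * (s\<^sup>2) ^ Suc k * (1 - 2 * phi_coeff k)"
        by (simp add: algebra_simps)
      moreover have "s * (s\<^sup>2) ^ Suc k = s ^ (2 * Suc k + 1)"
        unfolding power_mult power_add by simp
      ultimately show ?thesis by simp
    qed
    ultimately have "(\<lambda>k. 2 * s ^ (2 * Suc k + 1) / of_nat (2 * Suc k + 1)) sums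
            (2 * s * ((1 / (1 - s\<^sup>2) - 1) - 2 * s\<^sup>2 * phi_series (s\<^sup>2)))"
      by simp
    then have "(\<lambda>n. 2 * s ^ (2*n+1) / of_nat (2*n+1)) sums
            (2 * s * ((1 / (1 - s\<^sup>2) - 1) - 2 * s\<^sup>2 * phi_series (s\<^sup>2)) + 2 * s ^ (2*0+1) / of_nat (2*0+1))"
      by (subst sums_Suc_iff[symmetric]) simp
    then show ?thesis
      by (simp add: algebra_simps)
  qed
  ultimately show ?thesis
    unfolding x_def by (rule sums_unique2)
qed

lemma phi_eq_phi_series:
  assumes "0 \<le> s" "s < 1"
  shows "phi s = phi_series (s\<^sup>2)"
proof (cases "s = 0")
  case True
  have "phi_series 0 = phi_coeff 0"
    unfolding phi_series_def using powser_sums_zero[of phi_coeff] by (simp add: sums_iff)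
  then show ?thesis
    using True by (simp add: phi_def phi_coeff_def)
next
  case False
  have "s\<^sup>2 < 1"
    using assms by (simp add: power_less_one_iff)
  have *: "1 / (4 * s ^ 3) * (2 * s * (c - 2 * s\<^sup>2 * P)) = c / (2 * s\<^sup>2) - P" for c P :: real
    using False by (simp add: field_simps power2_eq_square power3_eq_cube)
  have "phi s = 1 / (2 * s\<^sup>2 * (1 - s\<^sup>2)) - 1 / (1 - s\<^sup>2) / (2 * s\<^sup>2) + phi_series (s\<^sup>2)"
    using False assms by (simp only: phi_def ln_eq_phi_series[of s] *) simp
  then show ?thesis
    by simp
qed

lemma deriv_phi:
  assumes "0 < s" "s < 1"
  shows "deriv phi s = 2 * s * phi_series' (s\<^sup>2)"
proof (rule DERIV_imp_deriv)
  have s2: "\<bar>s\<^sup>2\<bar> < 1"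
    using assms by (simp add: power_less_one_iff abs_square_less_1)
  have "((\<lambda>s. phi_series (s\<^sup>2)) has_real_derivative phi_series' (s\<^sup>2) * (2 * s)) (at s)"
    using phi_series_deriv[OF s2]
    by (rule DERIV_chain2[where g = "\<lambda>s. s\<^sup>2"]) (auto intro!: derivative_eq_intros)
  then have D: "((\<lambda>s. phi_series (s\<^sup>2)) has_real_derivative 2 * s * phi_series' (s\<^sup>2)) (at s)"
    by (simp add: mult_ac)
  show "(phi has_real_derivative 2 * s * phi_series' (s\<^sup>2)) (at s)"
    by (rule has_field_derivative_transform_within_open[OF D, of "{0<..<1}"])
       (use assms in \<open>auto simp: phi_eq_phi_series\<close>)
qed

lemma norm_sq_less_1:
  fixes u :: "'a::real_inner"
  assumes "norm u < 1"
  shows "u \<bullet> u < 1"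
  using assms by (simp add: dot_square_norm power_less_one_iff)

lemma mf_eq:
  assumes "norm u < 1"
  shows "mf \<rho> u w = (3 * m_e \<rho>) *\<^sub>R (phi_series (u \<bullet> u) *\<^sub>R w + (2 * phi_series' (u \<bullet> u) * (u \<bullet> w)) *\<^sub>R u)"
\<comment> \<open>At u = 0 the summand along u vanishes on both sides, so the values of
  \<open>inverse 0\<close> and \<open>deriv phi 0\<close> do not matter.\<close>
proof (cases "u = 0")
  case False
  then have "inverse (norm u) * deriv phi (norm u) = 2 * phi_series' ((norm u)\<^sup>2)"
    using assms by (simp add: deriv_phi)
  then show ?thesis
    using assms by (simp add: mf_def phi_eq_phi_series power2_norm_eq_inner)
qed (use phi_eq_phi_series[of 0] in \<open>simp add: mf_def\<close>)

section \<open>Positivity of the field mass and coercivity of the energy\<close>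

lemma m_e_nonneg: "0 \<le> m_e \<rho>"
proof -
  have "0 \<le> integral UNIV (\<lambda>k. (cmod (rho_hat \<rho> k))\<^sup>2 / (norm k)\<^sup>2)"
    \<comment> \<open>For a non-integrable integrand \<open>integral\<close> takes the value 0,
      which is nonnegative too.\<close>
    by (cases "(\<lambda>k. (cmod (rho_hat \<rho> k))\<^sup>2 / (norm k)\<^sup>2) integrable_on UNIV")
       (auto intro!: integral_nonneg simp: not_integrable_integral)
  then show ?thesis by (simp add: m_e_def)
qed

text \<open>\<open>Es\<close> as a function of \<open>u \<bullet> u\<close>, with the logarithm eliminated.\<close>

definition kinetic :: "real \<Rightarrow> real \<Rightarrow> real" where
  "kinetic m x = 1 / sqrt (1 - x) - 1 + 3 * m * (2 * x * phi_series x - x / (2 * (1 - x)))"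

lemma Es_eq_kinetic:
  assumes "norm u < 1"
  shows "Es \<rho> u = kinetic (m_e \<rho>) (u \<bullet> u)"
proof (cases "u = 0")
  case False
  define s where "s = norm u"
  have s: "0 < s" "s < 1" "s\<^sup>2 < 1"
    using assms False by (auto simp: s_def power_less_one_iff)
  have "(2 - s\<^sup>2) / (2 * (1 - s\<^sup>2)) - 1 / (2 * s) * ln ((1 + s) / (1 - s)) =
        2 * s\<^sup>2 * phi_series (s\<^sup>2) - s\<^sup>2 / (2 * (1 - s\<^sup>2))"
  proof -
    have "1 / (2 * s) * ln ((1 + s) / (1 - s)) = 1 / (1 - s\<^sup>2) - 2 * s\<^sup>2 * phi_series (s\<^sup>2)"
      unfolding ln_eq_phi_series[OF s(1,2)] using s by simp
    moreover have "(2 - s\<^sup>2) / (2 * (1 - s\<^sup>2)) = 1 / (1 - s\<^sup>2) - s\<^sup>2 / (2 * (1 - s\<^sup>2))"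
      using s by (simp add: divide_simps) (simp add: algebra_simps)
    ultimately show ?thesis
      by simp
  qed
  then show ?thesis
    using False by (simp add: Es_def kinetic_def lorentz_def s_def power2_norm_eq_inner)
qed (simp add: Es_def kinetic_def)

text \<open>The field part is nonnegative: the lower bound on the series gives 2x phi \<ge>
  2x/(3(1-x)), and 2/3 exceeds 1/2. So bounded energy bounds the Lorentz factor, which keeps |u|
  away from 1.\<close>

lemma Es_lower:
  assumes "norm u < 1"
  shows "lorentz u - 1 \<le> Es \<rho> u"
proof -
  define x where "x = u \<bullet> u"
  have x: "0 \<le> x" "x < 1"
    using norm_sq_less_1[OF assms] by (auto simp: x_def)
  have "2 * x * (1 / (3 * (1 - x))) \<le> 2 * x * phi_series x"
    using x by (intro mult_left_mono phi_series_lower) auto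
  moreover have "x / (2 * (1 - x)) \<le> 2 * x * (1 / (3 * (1 - x)))"
  proof -
    have "0 \<le> x * (1 - x)"
      using x by simp
    then show ?thesis
      using x by (simp add: field_simps)
  qed
  ultimately have "0 \<le> 3 * m_e \<rho> * (2 * x * phi_series x - x / (2 * (1 - x)))"
    using m_e_nonneg[of \<rho>] by (intro mult_nonneg_nonneg) auto
  then show ?thesis
    unfolding Es_eq_kinetic[OF assms]
    by (simp add: kinetic_def lorentz_def power2_norm_eq_inner x_def)
qed

text \<open>The derivative is put in the form (longitudinal mass)/2; the 1/2 compensates for d(u .
  u)/dt = 2 u . y. \<open>phi_series_ode\<close> supplies the cancellation.\<close>

lemma kinetic_deriv:
  assumes "0 \<le> x" "x < 1"
  shows "(kinetic m has_real_derivative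
           (1 / (sqrt (1 - x) ^ 3) + 3 * m * (phi_series x + 2 * x * phi_series' x)) / 2) (at x)"
proof -
  have D1: "((\<lambda>x. 1 / sqrt (1 - x)) has_real_derivative 1 / (2 * sqrt (1 - x) ^ 3)) (at x)"
  proof -
    define r where "r = sqrt (1 - x)"
    have "r > 0"
      using assms by (simp add: r_def)
    have "((\<lambda>x. sqrt (1 - x)) has_real_derivative - (inverse r / 2)) (at x)"
      using assms by (auto intro!: derivative_eq_intros simp: r_def)
    from DERIV_inverse'[OF this] \<open>r > 0\<close> show ?thesis
      by (simp add: r_def[symmetric] inverse_eq_divide power3_eq_cube mult_ac)
  qed
  have D2: "((\<lambda>x. x / (2 * (1 - x))) has_real_derivative 1 / (2 * (1 - x)\<^sup>2)) (at x)"
  proof -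
    have "((\<lambda>x. 2 * (1 - x)) has_real_derivative - 2) (at x)"
      by (auto intro!: derivative_eq_intros)
    from DERIV_divide[OF DERIV_ident this]
    have "((\<lambda>x. x / (2 * (1 - x))) has_real_derivative
        (1 * (2 * (1 - x)) - x * - 2) / (2 * (1 - x) * (2 * (1 - x)))) (at x)"
      using assms by simp
    then show ?thesis
      proof (rule DERIV_cong)
      have "2 / (2 * q * (2 * q)) = 1 / (2 * q\<^sup>2)" for q :: real
        by (simp add: power2_eq_square)
      from this[of "1 - x"]
      show "(1 * (2 * (1 - x)) - x * - 2) / (2 * (1 - x) * (2 * (1 - x))) = 1 / (2 * (1 - x)\<^sup>2)"
        by simp
    qed
  qed
  have D3: "(phi_series has_real_derivative phi_series' x) (at x)"
    using assms by (intro phi_series_deriv) auto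
  have D4: "((\<lambda>x. 2 * x) has_real_derivative 2) (at x)"
    by (auto intro!: derivative_eq_intros)
  have D: "(kinetic m has_real_derivative
        1 / (2 * sqrt (1 - x) ^ 3) - 0 + 3 * m * (2 * phi_series x + phi_series' x * (2 * x) - 1 / (2 * (1 - x)\<^sup>2))) (at x)"
    unfolding kinetic_def[abs_def]
    by (intro DERIV_add DERIV_diff DERIV_cmult D1 D2 DERIV_const DERIV_mult D3 D4)
  have ode: "1 / (2 * (1 - x)\<^sup>2) = (3 * phi_series x + 2 * x * phi_series' x) / 2"
    using phi_series_ode[of x] assms by simp
  show ?thesis
    using D unfolding ode by (rule DERIV_cong) (simp add: add_divide_distrib algebra_simps)
qed

section \<open>Energy balance\<close>

lemma lorentz_even_power:
  assumes "norm u < 1"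
  shows "lorentz u ^ (2 * n) = inverse (1 - u \<bullet> u) ^ n"
proof -
  have "lorentz u ^ 2 = inverse (1 - u \<bullet> u)"
    using norm_sq_less_1[OF assms]
    by (simp add: lorentz_def power_divide power2_norm_eq_inner inverse_eq_divide)
  then show ?thesis
    by (simp add: power_mult)
qed

text \<open>The coefficient is the longitudinal mass, twice the derivative in
  \<open>kinetic_deriv\<close>. Hence u . m(u)y is the rate of change of \<open>Es\<close> along a
  path with velocity derivative y.\<close>

lemma inner_mass:
  assumes "norm u < 1"
  shows "u \<bullet> mass \<rho> u y =
    (1 / sqrt (1 - u \<bullet> u) ^ 3 + 3 * m_e \<rho> * (phi_series (u \<bullet> u) + 2 * (u \<bullet> u) * phi_series' (u \<bullet> u))) * (u \<bullet> y)"
proof -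
  define q where "q = sqrt (1 - u \<bullet> u)"
  have q: "q > 0" "u \<bullet> u = 1 - q\<^sup>2"
    using norm_sq_less_1[OF assms] by (auto simp: q_def)
  have "1 / q + (1 / q) ^ 3 * (1 - q\<^sup>2) = 1 / q ^ 3"
    using q by (simp add: field_simps power2_eq_square power3_eq_cube)
  moreover have "u \<bullet> m0 u y = (1 / q + (1 / q) ^ 3 * (u \<bullet> u)) * (u \<bullet> y)"
    unfolding m0_def lorentz_def power2_norm_eq_inner q_def[symmetric] inner_add_right inner_scaleR_right
    by (simp add: algebra_simps)
  ultimately have "u \<bullet> m0 u y = 1 / q ^ 3 * (u \<bullet> y)"
    by (simp only: q(2))
  moreover have "u \<bullet> mf \<rho> u y = 3 * m_e \<rho> * (phi_series (u \<bullet> u) + 2 * (u \<bullet> u) * phi_series' (u \<bullet> u)) * (u \<bullet> y)"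
    by (simp add: mf_eq[OF assms] inner_add_right algebra_simps)
  ultimately show ?thesis
    unfolding q_def mass_def inner_add_right distrib_right by simp
qed

section \<open>Components of the radiation reaction along the velocity\<close>

definition rad_coeff :: "(vec3 \<Rightarrow> real) \<Rightarrow> real" where
  "rad_coeff \<rho> = (charge \<rho>)\<^sup>2 / (12 * pi)"

text \<open>The eigenvalue of \<open>acoef\<close> in the direction u, divided by
  \<open>rad_coeff\<close>, as a function of x = u . u; \<open>inverse (1 - x)\<close> is the
  squared Lorentz factor.\<close>

definition rad_weight :: "real \<Rightarrow> real" where
  "rad_weight x = inverse (1 - x) ^ 2 + 4 * x * inverse (1 - x) ^ 3"

lemma rad_coeff_nonneg: "0 \<le> rad_coeff \<rho>"
  by (simp add: rad_coeff_def)

lemma rad_weight_deriv: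
  assumes "x < 1"
  shows "(rad_weight has_real_derivative 6 * inverse (1 - x) ^ 3 + 12 * x * inverse (1 - x) ^ 4) (at x)"
proof -
  have D: "((\<lambda>x. inverse (1 - x)) has_real_derivative inverse (1 - x) ^ 2) (at x)"
    using assms by (auto intro!: derivative_eq_intros simp: power2_eq_square)
  show ?thesis
    unfolding rad_weight_def[abs_def]
    by (rule derivative_eq_intros D refl | simp)+ (simp add: algebra_simps power_numeral_reduce)
qed

lemma rad_weight_mono:
  assumes "0 \<le> x" "x \<le> x'" "x' < 1"
  shows "0 \<le> rad_weight x" "rad_weight x \<le> rad_weight x'"
proof -
  have "inverse (1 - x) \<le> inverse (1 - x')" "0 \<le> inverse (1 - x)"
    using assms by auto
  then show "0 \<le> rad_weight x" "rad_weight x \<le> rad_weight x'"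
    unfolding rad_weight_def using assms
    by (auto intro!: add_mono mult_mono power_mono)
qed

lemma acoef_eq:
  assumes "norm u < 1"
  shows "acoef \<rho> u w = rad_coeff \<rho> *\<^sub>R
    (inverse (1 - u \<bullet> u) ^ 2 *\<^sub>R w + (4 * inverse (1 - u \<bullet> u) ^ 3 * (u \<bullet> w)) *\<^sub>R u)"
  using lorentz_even_power[OF assms, of 2] lorentz_even_power[OF assms, of 3]
  by (simp add: acoef_def rad_coeff_def)

lemma bcoef_eq:
  assumes "norm u < 1"
  shows "bcoef \<rho> u w = (3 * rad_coeff \<rho>) *\<^sub>R
    ((2 * inverse (1 - u \<bullet> u) ^ 3 * (u \<bullet> w)) *\<^sub>R w + (inverse (1 - u \<bullet> u) ^ 3 * (w \<bullet> w)) *\<^sub>R u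
     + (6 * inverse (1 - u \<bullet> u) ^ 4 * (u \<bullet> w)\<^sup>2) *\<^sub>R u)"
  using lorentz_even_power[OF assms, of 3] lorentz_even_power[OF assms, of 4]
  by (simp add: bcoef_def rad_coeff_def power2_norm_eq_inner)

lemma inner_acoef:
  assumes "norm u < 1"
  shows "u \<bullet> acoef \<rho> u z = rad_coeff \<rho> * rad_weight (u \<bullet> u) * (u \<bullet> z)"
  by (simp add: acoef_eq[OF assms] inner_add_right rad_weight_def algebra_simps)

text \<open>The right-hand side is arranged for differentiating rad_weight(u . u)(u . y): its first
  two terms, 2 rad_weight' (u . y)^2 + rad_weight |y|^2, are what that derivative contains besides
  rad_weight (u . y'). The other two are negative and form the dissipation. The rearrangement rests
  on x w = w - 1.\<close>

lemma inner_bcoef: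
  assumes "norm u < 1"
  shows "u \<bullet> bcoef \<rho> u y = rad_coeff \<rho> *
    (2 * (6 * inverse (1 - u \<bullet> u) ^ 3 + 12 * (u \<bullet> u) * inverse (1 - u \<bullet> u) ^ 4) * (u \<bullet> y)\<^sup>2
     + rad_weight (u \<bullet> u) * (y \<bullet> y)
     - inverse (1 - u \<bullet> u) ^ 3 * (y \<bullet> y) - 6 * inverse (1 - u \<bullet> u) ^ 4 * (u \<bullet> y)\<^sup>2)"
proof -
  define w where "w = inverse (1 - u \<bullet> u)"
  define x where "x = u \<bullet> u"
  define p where "p = u \<bullet> y"
  have "(1 - u \<bullet> u) * w = 1"
    using norm_sq_less_1[OF assms] by (simp add: w_def)
  then have xw: "x * w = w - 1"
    by (simp add: algebra_simps x_def)
  have 3: "x * w ^ 3 = w ^ 3 - w ^ 2" and 4: "x * w ^ 4 = w ^ 4 - w ^ 3"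
    using arg_cong[OF xw, of "\<lambda>z. z * w ^ 2"] arg_cong[OF xw, of "\<lambda>z. z * w ^ 3"]
    by (simp_all add: algebra_simps power_numeral_reduce)
  have "u \<bullet> bcoef \<rho> u y = rad_coeff \<rho> * (6 * w ^ 3 * p\<^sup>2 + 3 * (x * w ^ 3) * (y \<bullet> y) + 18 * (x * w ^ 4) * p\<^sup>2)"
    unfolding w_def x_def p_def
    by (simp add: bcoef_eq[OF assms] inner_add_right power2_eq_square algebra_simps)
  also have "\<dots> = rad_coeff \<rho> *
    (2 * (6 * w ^ 3 + 12 * (x * w ^ 4)) * p\<^sup>2 + (w ^ 2 + 4 * (x * w ^ 3)) * (y \<bullet> y) - w ^ 3 * (y \<bullet> y) - 6 * w ^ 4 * p\<^sup>2)"
    unfolding 3 4 by (simp add: algebra_simps)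
  finally show ?thesis
    unfolding rad_weight_def w_def x_def p_def by (simp add: mult.assoc)
qed

lemma inner_grad:
  assumes "V differentiable at x"
  shows "grad V x \<bullet> v = frechet_derivative V (at x) v"
proof -
  interpret bounded_linear "frechet_derivative V (at x)"
    using assms by (meson frechet_derivative_works has_derivative_bounded_linear)
  have "v = (\<Sum>i\<in>UNIV. v $ i *\<^sub>R axis i 1)"
    by (metis basis_expansion scalar_mult_eq_scaleR)
  then have "frechet_derivative V (at x) v = frechet_derivative V (at x) (\<Sum>i\<in>UNIV. v $ i *\<^sub>R axis i 1)"
    by (rule arg_cong)
  also have "\<dots> = (\<Sum>i\<in>UNIV. v $ i * frechet_derivative V (at x) (axis i 1))"
    by (simp add: sum scaleR)
  finally show ?thesis
    by (simp add: inner_vec_def grad_def mult.commute)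
qed

text \<open>The Schott term \<open>rad_weight (u \<bullet> u) * (u \<bullet> y)\<close> absorbs the part of
  \<open>u \<bullet> a(u) y' + u \<bullet> b(u, y)\<close> that is a total time derivative; the rest is nonpositive.\<close>

definition schott_energy ::
  "(vec3 \<Rightarrow> real) \<Rightarrow> (vec3 \<Rightarrow> real) \<Rightarrow> real \<Rightarrow> vec3 \<Rightarrow> vec3 \<Rightarrow> vec3 \<Rightarrow> real" where
  "schott_energy \<rho> V \<epsilon> r u y = Ham \<rho> V r u - \<epsilon> * rad_coeff \<rho> * (rad_weight (u \<bullet> u) * (u \<bullet> y))"

lemma schott_energy_nonincreasing:
  assumes sol: "effective_solution \<rho> V \<epsilon> {0..<T} r u y"
    and diff: "\<And>x. V differentiable at x" and "0 \<le> \<epsilon>" and t: "0 \<le> t" "t < T"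
  shows "schott_energy \<rho> V \<epsilon> (r t) (u t) (y t) \<le> schott_energy \<rho> V \<epsilon> (r 0) (u 0) (y 0)"
proof -
  \<comment> \<open>\<open>kinetic\<close> replaces \<open>Es\<close>, whose case distinction at u =
    0 would obstruct differentiation; the two agree along the solution because |u| < 1.\<close>
  define \<Phi> where "\<Phi> s = kinetic (m_e \<rho>) (u s \<bullet> u s) + V (r s)
      - \<epsilon> * rad_coeff \<rho> * (rad_weight (u s \<bullet> u s) * (u s \<bullet> y s))" for s
  have eq: "schott_energy \<rho> V \<epsilon> (r s) (u s) (y s) = \<Phi> s" if "s \<in> {0..t}" for s
    using sol that t by (auto simp: schott_energy_def \<Phi>_def Ham_def Es_eq_kinetic
        effective_solution_def is_solution_def)
  have deriv: "\<exists>D\<le>0. (\<Phi> has_real_derivative D) (at s within {0..t})" if s: "s \<in> {0..t}" for s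
  proof -
    have sub: "{0..t} \<subseteq> {0..<T}" and sT: "s \<in> {0..<T}"
      using s t by auto
    define p where "p = u s \<bullet> y s"
    define x where "x = u s \<bullet> u s"
    from sol sT obtain z where un: "norm (u s) < 1"
      and r': "(r has_vector_derivative u s) (at s within {0..<T})"
      and u': "(u has_vector_derivative y s) (at s within {0..<T})"
      and y': "(y has_vector_derivative z) (at s within {0..<T})"
      and eqn: "mass \<rho> (u s) (y s) = - grad V (r s) + \<epsilon> *\<^sub>R acoef \<rho> (u s) z + \<epsilon> *\<^sub>R bcoef \<rho> (u s) (y s)"
      unfolding effective_solution_def is_solution_def by blast
    note r = has_vector_derivative_within_subset[OF r' sub]
    note u = has_vector_derivative_within_subset[OF u' sub]
    note y = has_vector_derivative_within_subset[OF y' sub]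
    have x: "0 \<le> x" "x < 1"
      using norm_sq_less_1[OF un] by (auto simp: x_def)
    have dx: "((\<lambda>s. u s \<bullet> u s) has_real_derivative 2 * p) (at s within {0..t})"
      using bounded_bilinear.has_vector_derivative[OF bounded_bilinear_inner u u]
      by (simp add: has_real_derivative_iff_has_vector_derivative p_def inner_commute)
    have dp: "((\<lambda>s. u s \<bullet> y s) has_real_derivative (u s \<bullet> z + y s \<bullet> y s)) (at s within {0..t})"
      using bounded_bilinear.has_vector_derivative[OF bounded_bilinear_inner u y]
      by (simp add: has_real_derivative_iff_has_vector_derivative)
    have dV: "((\<lambda>s. V (r s)) has_real_derivative grad V (r s) \<bullet> u s) (at s within {0..t})"
    proof -
      have "(V has_derivative frechet_derivative V (at (r s))) (at (r s))"
        using diff frechet_derivative_works by blast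
      from has_derivative_compose[OF r[unfolded has_vector_derivative_def] this]
      have "((\<lambda>s. V (r s)) has_derivative (\<lambda>h. frechet_derivative V (at (r s)) (h *\<^sub>R u s))) (at s within {0..t})" .
      moreover have "frechet_derivative V (at (r s)) (h *\<^sub>R u s) = (grad V (r s) \<bullet> u s) * h" for h
        using inner_grad[OF diff, of "r s" "h *\<^sub>R u s"] by (simp add: mult.commute)
      ultimately show ?thesis
        by (simp add: has_field_derivative_def)
    qed
    define E where "E = 1 / sqrt (1 - x) ^ 3 + 3 * m_e \<rho> * (phi_series x + 2 * x * phi_series' x)"
    define g' where "g' = 6 * inverse (1 - x) ^ 3 + 12 * x * inverse (1 - x) ^ 4"
    have dE: "((\<lambda>s. kinetic (m_e \<rho>) (u s \<bullet> u s)) has_real_derivative (E / 2) * (2 * p)) (at s within {0..t})"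
      using kinetic_deriv[OF x, of "m_e \<rho>"] dx unfolding E_def x_def by (rule DERIV_chain2)
    have dg: "((\<lambda>s. rad_weight (u s \<bullet> u s)) has_real_derivative g' * (2 * p)) (at s within {0..t})"
      using rad_weight_deriv[OF x(2)] dx unfolding g'_def x_def by (rule DERIV_chain2)
    have D: "(\<Phi> has_real_derivative
        (E / 2) * (2 * p) + grad V (r s) \<bullet> u s
        - \<epsilon> * rad_coeff \<rho> * (g' * (2 * p) * (u s \<bullet> y s) + (u s \<bullet> z + y s \<bullet> y s) * rad_weight (u s \<bullet> u s))) (at s within {0..t})"
      unfolding \<Phi>_def[abs_def]
      by (intro DERIV_diff DERIV_add DERIV_cmult DERIV_mult dE dV dg dp)
    \<comment> \<open>Take the inner product of the effective equation with the velocity.\<close>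
    have "E * p = u s \<bullet> mass \<rho> (u s) (y s)"
      unfolding inner_mass[OF un] E_def x_def p_def ..
    also have "\<dots> = - (grad V (r s) \<bullet> u s) + \<epsilon> * (u s \<bullet> acoef \<rho> (u s) z) + \<epsilon> * (u s \<bullet> bcoef \<rho> (u s) (y s))"
      unfolding eqn by (simp add: inner_diff_right inner_add_right inner_commute)
    finally have Ep: "E * p = - (grad V (r s) \<bullet> u s) + \<epsilon> * (rad_coeff \<rho> * rad_weight x * (u s \<bullet> z))
       + \<epsilon> * (rad_coeff \<rho> * (2 * g' * p\<^sup>2 + rad_weight x * (y s \<bullet> y s)
               - inverse (1 - x) ^ 3 * (y s \<bullet> y s) - 6 * inverse (1 - x) ^ 4 * p\<^sup>2))"
      unfolding inner_acoef[OF un] inner_bcoef[OF un] g'_def x_def p_def .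
    \<comment> \<open>Substituting \<open>Ep\<close>, the potential term and everything without a
      sign cancel against the derivative of the Schott term; minus the radiated power is
      left.\<close>
    have "(E / 2) * (2 * p) + grad V (r s) \<bullet> u s
        - \<epsilon> * rad_coeff \<rho> * (g' * (2 * p) * (u s \<bullet> y s) + (u s \<bullet> z + y s \<bullet> y s) * rad_weight (u s \<bullet> u s))
      = - (\<epsilon> * rad_coeff \<rho> * (inverse (1 - x) ^ 3 * (y s \<bullet> y s) + 6 * inverse (1 - x) ^ 4 * p\<^sup>2))"
      using Ep by (simp add: p_def[symmetric] x_def[symmetric] power2_eq_square algebra_simps)
    also have "\<dots> \<le> 0"
      using \<open>0 \<le> \<epsilon>\<close> rad_coeff_nonneg[of \<rho>] x by simp
    finally show ?thesis
      using D by blast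
  qed
  then obtain D where D: "\<And>s. s \<in> {0..t} \<Longrightarrow> D s \<le> 0"
      "\<And>s. s \<in> {0..t} \<Longrightarrow> (\<Phi> has_real_derivative D s) (at s within {0..t})"
    by metis
  have "\<exists>s\<in>{0..t}. \<Phi> t - \<Phi> 0 = D s * (t - 0)"
    using t D(2) by (intro mvt_very_simple) (auto simp: has_field_derivative_def)
  then obtain s where "s \<in> {0..t}" "\<Phi> t - \<Phi> 0 = D s * t"
    by auto
  moreover have "D s * t \<le> 0"
    using D(1) \<open>s \<in> {0..t}\<close> t by (simp add: mult_nonpos_nonneg)
  ultimately show ?thesis
    using eq[of t] eq[of 0] t by simp
qed

text \<open>The Schott term enters only through its values at 0 and t, so the error does not grow
  with time. As |u| < 1 and \<open>rad_weight\<close> is increasing, each value is at most eps kappa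
  g(\<sigma>^2) C; the factor 2 in \<open>small\<close> makes this 1/2.\<close>

lemma Ham_bound:
  assumes sol: "effective_solution \<rho> V \<epsilon> {0..<T} r u y"
    and diff: "\<And>x. V differentiable at x" and "0 \<le> \<epsilon>" and t: "0 \<le> t" "t < T"
    and "\<sigma> < 1" and u: "\<And>s. s \<in> {0..<T} \<Longrightarrow> norm (u s) \<le> \<sigma>"
    and y: "\<And>s. s \<in> {0..<T} \<Longrightarrow> norm (y s) \<le> C"
    and small: "2 * \<epsilon> * rad_coeff \<rho> * rad_weight (\<sigma>\<^sup>2) * C \<le> 1"
  shows "Ham \<rho> V (r t) (u t) \<le> Ham \<rho> V (r 0) (u 0) + 1"
proof -
  have schott: "\<bar>\<epsilon> * rad_coeff \<rho> * (rad_weight (u s \<bullet> u s) * (u s \<bullet> y s))\<bar> \<le> 1/2"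
    if s: "s \<in> {0..<T}" for s
  proof -
    have n: "norm (u s) \<le> \<sigma>" "norm (u s) < 1" "norm (y s) \<le> C"
      using u[OF s] y[OF s] \<open>\<sigma> < 1\<close> by auto
    have "0 \<le> \<sigma>"
      using n(1) norm_ge_zero order_trans by blast
    have "u s \<bullet> u s \<le> \<sigma>\<^sup>2" "\<sigma>\<^sup>2 < 1"
      using n \<open>0 \<le> \<sigma>\<close> \<open>\<sigma> < 1\<close> by (auto simp: dot_square_norm power_mono power_less_one_iff)
    then have w: "0 \<le> rad_weight (u s \<bullet> u s)" "rad_weight (u s \<bullet> u s) \<le> rad_weight (\<sigma>\<^sup>2)"
      using rad_weight_mono[of "u s \<bullet> u s" "\<sigma>\<^sup>2"] by auto
    have "\<bar>u s \<bullet> y s\<bar> \<le> norm (u s) * norm (y s)"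
      by (rule Cauchy_Schwarz_ineq2)
    also have "\<dots> \<le> 1 * C"
      using n by (intro mult_mono) auto
    finally have "\<bar>u s \<bullet> y s\<bar> \<le> C" by simp
    then have "\<bar>rad_weight (u s \<bullet> u s) * (u s \<bullet> y s)\<bar> \<le> rad_weight (\<sigma>\<^sup>2) * C"
      using w unfolding abs_mult by (intro mult_mono) auto
    then have "(\<epsilon> * rad_coeff \<rho>) * \<bar>rad_weight (u s \<bullet> u s) * (u s \<bullet> y s)\<bar>
        \<le> (\<epsilon> * rad_coeff \<rho>) * (rad_weight (\<sigma>\<^sup>2) * C)"
      using \<open>0 \<le> \<epsilon>\<close> rad_coeff_nonneg[of \<rho>] by (intro mult_left_mono) auto
    moreover have "\<bar>\<epsilon> * rad_coeff \<rho> * (rad_weight (u s \<bullet> u s) * (u s \<bullet> y s))\<bar>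
        = (\<epsilon> * rad_coeff \<rho>) * \<bar>rad_weight (u s \<bullet> u s) * (u s \<bullet> y s)\<bar>"
      using \<open>0 \<le> \<epsilon>\<close> rad_coeff_nonneg[of \<rho>] by (simp add: abs_mult)
    ultimately show ?thesis
      using small by (simp add: mult_ac)
  qed
  from schott_energy_nonincreasing[OF sol diff \<open>0 \<le> \<epsilon>\<close> t] schott[of t] schott[of 0] t
  show ?thesis
    by (simp add: schott_energy_def)
qed

text \<open>V is bounded below and \<open>Es\<close> dominates the Lorentz factor minus 1, so the
  sublevel set has a uniform bound on the Lorentz factor. The given point (x, v) makes the set
  nonempty, without which its supremum would be meaningless.\<close>

lemma s0_bounds:
  assumes bdd: "bdd_below (range V)" and nonempty: "norm v < 1" "Ham \<rho> V x v \<le> c + 1"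
  shows "s0 \<rho> V c < 1"
    and "\<And>r u. norm u < 1 \<Longrightarrow> Ham \<rho> V r u \<le> c + 1 \<Longrightarrow> norm u \<le> s0 \<rho> V c"
proof -
  let ?S = "{norm u | u r. norm u < 1 \<and> Ham \<rho> V r u \<le> c + 1}"
  from bdd obtain b where b: "\<And>r. b \<le> V r"
    by (auto simp: bdd_below_def)
  \<comment> \<open>c + 2 - b collects the level c + 1, the lower bound b of V and the 1 subtracted
    from the Lorentz factor; the maximum with 1 makes K positive and 1 - 1/K^2 nonnegative.\<close>
  define K where "K = max 1 (c + 2 - b)"
  have K: "K \<ge> 1" "c + 2 - b \<le> K"
    by (auto simp: K_def)
  have bound: "norm u \<le> sqrt (1 - 1 / K\<^sup>2)" if "norm u < 1" "Ham \<rho> V r u \<le> c + 1" for r u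
  proof -
    define q where "q = sqrt (1 - u \<bullet> u)"
    have q: "q > 0" "q\<^sup>2 = 1 - u \<bullet> u"
      using norm_sq_less_1[OF that(1)] by (auto simp: q_def)
    have "1 / q \<le> K"
      using Es_lower[OF that(1), of \<rho>] that(2) b[of r] K(2)
      by (simp add: Ham_def lorentz_def q_def power2_norm_eq_inner)
    then have "1 / K \<le> q"
      using q K by (simp add: field_simps)
    then have "(1 / K)\<^sup>2 \<le> q\<^sup>2"
      using K by (intro power_mono) auto
    then have "norm u ^ 2 \<le> 1 - 1 / K\<^sup>2"
      using q by (simp add: power2_norm_eq_inner power_divide)
    then show ?thesis
      by (rule real_le_rsqrt)
  qed
  have "s0 \<rho> V c \<le> sqrt (1 - 1 / K\<^sup>2)"
    unfolding s0_def using bound nonempty by (intro cSup_least) auto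
  also have "\<dots> < 1"
    using K by (intro real_sqrt_lt_1_iff[THEN iffD2]) auto
  finally show "s0 \<rho> V c < 1" .
  show "norm u \<le> s0 \<rho> V c" if "norm u < 1" "Ham \<rho> V r u \<le> c + 1" for r u
    unfolding s0_def using that bound by (intro cSup_upper bdd_aboveI[of _ "sqrt (1 - 1 / K\<^sup>2)"]) auto
qed

section \<open>Bounded Lipschitz functions and global solutions\<close>

text \<open>The times at which the path is outside W form a closed set, so there would be a first
  one, and \<open>step\<close> excludes it. \<open>step\<close> sees only times strictly before t,
  which suits solutions on half-open intervals.\<close>

lemma continuation_principle:
  fixes f :: "real \<Rightarrow> 'a::topological_space"
  assumes cont: "\<And>t. 0 \<le> t \<Longrightarrow> t \<in> I \<Longrightarrow> continuous_on {0..t} f"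
    and "open W" and "f 0 \<in> W"
    and step: "\<And>t. \<lbrakk>0 < t; t \<in> I; \<And>s. s \<in> {0..<t} \<Longrightarrow> f s \<in> W\<rbrakk> \<Longrightarrow> f t \<in> W"
    and t: "0 \<le> t" "{0..t} \<subseteq> I"
  shows "f t \<in> W"
proof (rule ccontr)
  assume "f t \<notin> W"
  define S where "S = {0..t} \<inter> f -` (- W)"
  have "continuous_on {0..t} f"
    using cont t by auto
  then have "closed S"
    unfolding S_def using \<open>open W\<close> by (intro continuous_closed_preimage) auto
  have "S \<noteq> {}" and S: "bdd_below S" 
    using \<open>f t \<notin> W\<close> t by (auto simp: S_def intro!: bdd_belowI[of _ 0])
  define \<tau> where "\<tau> = Inf S"
  have "\<tau> \<in> S"
    unfolding \<tau>_def using closed_contains_Inf \<open>closed S\<close> \<open>S \<noteq> {}\<close> S by blast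
  then have \<tau>: "\<tau> \<in> {0..t}" "f \<tau> \<notin> W"
    by (auto simp: S_def)
  have "f s \<in> W" if "s \<in> {0..<\<tau>}" for s
  proof (rule ccontr)
    assume "f s \<notin> W"
    then have "s \<in> S"
      using that \<tau> by (auto simp: S_def)
    then have "\<tau> \<le> s"
      unfolding \<tau>_def using S by (rule cInf_lower)
    then show False
      using that by simp
  qed
  moreover have "\<tau> \<noteq> 0"
    using \<tau> \<open>f 0 \<in> W\<close> by auto
  ultimately show False
    using step[of \<tau>] \<tau> t by auto
qed

text \<open>Lipschitz functions alone are not closed under products; adding boundedness makes the
  class closed under every bounded bilinear operation, so that membership of the vector field can be
  read off its formula.\<close>

definition bounded_lipschitz :: "('a::metric_space \<Rightarrow> 'b::real_normed_vector) \<Rightarrow> bool" where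
  "bounded_lipschitz f \<longleftrightarrow> (\<exists>L. L-lipschitz_on UNIV f) \<and> bounded (range f)"

lemma bounded_lipschitzE:
  assumes "bounded_lipschitz f"
  obtains L B where "0 \<le> L" "\<And>x y. norm (f x - f y) \<le> L * dist x y" "0 \<le> B" "\<And>x. norm (f x) \<le> B"
proof -
  from assms obtain L where L: "L-lipschitz_on UNIV f"
    unfolding bounded_lipschitz_def by blast
  moreover from assms obtain B where "\<And>x. norm (f x) \<le> B"
    unfolding bounded_lipschitz_def bounded_iff by auto
  moreover from this have "0 \<le> B"
    using norm_ge_zero order_trans by blast
  ultimately show ?thesis
    using that lipschitz_on_nonneg[OF L] lipschitz_onD[OF L] by (auto simp: dist_norm)
qed

lemma bounded_lipschitzI:
  assumes "\<And>x y. norm (f x - f y) \<le> L * dist x y" "\<And>x. norm (f x) \<le> B"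
  shows "bounded_lipschitz f"
proof -
  have "\<bar>L\<bar>-lipschitz_on UNIV f"
  proof (rule lipschitz_onI)
    fix x y
    have "dist (f x) (f y) \<le> L * dist x y"
      using assms(1) by (simp add: dist_norm)
    also have "\<dots> \<le> \<bar>L\<bar> * dist x y"
      by (intro mult_right_mono) auto
    finally show "dist (f x) (f y) \<le> \<bar>L\<bar> * dist x y" .
  qed auto
  then show ?thesis
    using assms(2) unfolding bounded_lipschitz_def bounded_iff by auto
qed

lemma bounded_lipschitz_bilinear:
  assumes "bounded_bilinear mul" "bounded_lipschitz f" "bounded_lipschitz g"
  shows "bounded_lipschitz (\<lambda>x. mul (f x) (g x))"
proof -
  interpret bounded_bilinear mul by fact
  from assms(2) obtain L B where f: "0 \<le> L" "\<And>x y. norm (f x - f y) \<le> L * dist x y" "0 \<le> B" "\<And>x. norm (f x) \<le> B"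
    by (rule bounded_lipschitzE) blast
  from assms(3) obtain M D where g: "0 \<le> M" "\<And>x y. norm (g x - g y) \<le> M * dist x y" "0 \<le> D" "\<And>x. norm (g x) \<le> D"
    by (rule bounded_lipschitzE) blast
  obtain K where K: "0 \<le> K" "\<And>a b. norm (mul a b) \<le> norm a * norm b * K"
    using nonneg_bounded by blast
  show ?thesis
  proof (rule bounded_lipschitzI)
    fix x y
    have "mul (f x) (g x) - mul (f y) (g y) = mul (f x - f y) (g x) + mul (f y) (g x - g y)"
      by (simp add: diff_left diff_right)
    then have "norm (mul (f x) (g x) - mul (f y) (g y))
        \<le> norm (mul (f x - f y) (g x)) + norm (mul (f y) (g x - g y))"
      by (metis norm_triangle_ineq)
    also have "\<dots> \<le> norm (f x - f y) * norm (g x) * K + norm (f y) * norm (g x - g y) * K"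
      by (intro add_mono K)
    also have "\<dots> \<le> (L * dist x y) * D * K + B * (M * dist x y) * K"
      using f g K by (intro add_mono mult_mono mult_nonneg_nonneg) auto
    also have "\<dots> = (L * D * K + B * M * K) * dist x y"
      by (simp add: algebra_simps)
    finally show "norm (mul (f x) (g x) - mul (f y) (g y)) \<le> (L * D * K + B * M * K) * dist x y" .
    have "norm (mul (f x) (g x)) \<le> norm (f x) * norm (g x) * K"
      by (rule K)
    also have "\<dots> \<le> B * D * K"
      using f g K by (intro mult_mono mult_nonneg_nonneg) auto
    finally show "norm (mul (f x) (g x)) \<le> B * D * K" .
  qed
qed

lemma bounded_lipschitz_add:
  assumes "bounded_lipschitz f" "bounded_lipschitz g"
  shows "bounded_lipschitz (\<lambda>x. f x + g x)"
proof -
  from assms(1) obtain L B where f: "0 \<le> L" "\<And>x y. norm (f x - f y) \<le> L * dist x y" "0 \<le> B" "\<And>x. norm (f x) \<le> B"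
    by (rule bounded_lipschitzE) blast
  from assms(2) obtain M D where g: "0 \<le> M" "\<And>x y. norm (g x - g y) \<le> M * dist x y" "0 \<le> D" "\<And>x. norm (g x) \<le> D"
    by (rule bounded_lipschitzE) blast
  show ?thesis
  proof (rule bounded_lipschitzI)
    fix x y
    have "norm (f x + g x - (f y + g y)) \<le> norm (f x - f y) + norm (g x - g y)"
      by (rule norm_diff_triangle_ineq)
    also have "\<dots> \<le> (L + M) * dist x y"
      using add_mono[OF f(2) g(2)] by (simp add: algebra_simps)
    finally show "norm (f x + g x - (f y + g y)) \<le> (L + M) * dist x y" .
    show "norm (f x + g x) \<le> B + D"
      using f(4) g(4) by (intro norm_triangle_mono)
  qed
qed

lemma bounded_lipschitz_const: "bounded_lipschitz (\<lambda>x. c)"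
  by (rule bounded_lipschitzI[where L = 0 and B = "norm c"]) auto

lemmas bounded_lipschitz_scaleR = bounded_lipschitz_bilinear[OF bounded_bilinear_scaleR]
lemmas bounded_lipschitz_mult = bounded_lipschitz_bilinear[OF bounded_bilinear_mult]
lemmas bounded_lipschitz_inner = bounded_lipschitz_bilinear[OF bounded_bilinear_inner]

lemma bounded_lipschitz_diff:
  assumes "bounded_lipschitz f" "bounded_lipschitz g"
  shows "bounded_lipschitz (\<lambda>x. f x - g x)"
proof -
  have "bounded_lipschitz (\<lambda>x. f x + (-1) *\<^sub>R g x)"
    by (intro bounded_lipschitz_add bounded_lipschitz_scaleR bounded_lipschitz_const assms)
  then show ?thesis by simp
qed

lemma bounded_lipschitz_power:
  fixes f :: "'a::metric_space \<Rightarrow> real"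
  assumes "bounded_lipschitz f"
  shows "bounded_lipschitz (\<lambda>x. f x ^ n)"
  by (induction n) (auto intro!: bounded_lipschitz_const bounded_lipschitz_mult assms)

text \<open>On the compact interval g and g' are bounded, and the mean value inequality applies.
  This admits functions such as \<open>inverse (1 - s)\<close> that are singular outside the range
  of f.\<close>

lemma bounded_lipschitz_compose_deriv:
  fixes f :: "'a::metric_space \<Rightarrow> real"
  assumes f: "bounded_lipschitz f" "\<And>x. f x \<in> {a..b}"
    and g: "\<And>s. s \<in> {a..b} \<Longrightarrow> (g has_real_derivative g' s) (at s)"
    and g': "continuous_on {a..b} g'"
  shows "bounded_lipschitz (\<lambda>x. g (f x))"
proof -
  have cont: "continuous_on {a..b} g"
    by (rule DERIV_continuous_on) (rule has_field_derivative_at_within[OF g])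
  obtain B where B: "\<And>s. s \<in> {a..b} \<Longrightarrow> norm (g s) \<le> B"
    using compact_imp_bounded[OF compact_continuous_image[OF cont compact_Icc]]
    unfolding bounded_iff by blast
  obtain M where M: "\<And>s. s \<in> {a..b} \<Longrightarrow> norm (g' s) \<le> M"
    using compact_imp_bounded[OF compact_continuous_image[OF g' compact_Icc]]
    unfolding bounded_iff by blast
  \<comment> \<open>\<open>f undefined\<close> merely names some point of
    \<open>{a..b}\<close>.\<close>
  have "0 \<le> M"
    using M[of "f undefined"] f(2) norm_ge_zero order_trans by blast
  from f(1) obtain L where L: "0 \<le> L" "\<And>x y. norm (f x - f y) \<le> L * dist x y"
    by (rule bounded_lipschitzE) blast
  show ?thesis
  proof (rule bounded_lipschitzI)
    fix x y
    have "norm (g (f x) - g (f y)) \<le> M * norm (f x - f y)"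
      by (rule field_differentiable_bound[of "{a..b}" g g'])
         (use f(2) g M in \<open>auto intro: has_field_derivative_at_within\<close>)
    also have "\<dots> \<le> M * (L * dist x y)"
      using L \<open>0 \<le> M\<close> by (intro mult_left_mono) auto
    finally show "norm (g (f x) - g (f y)) \<le> (M * L) * dist x y"
      by (simp add: mult_ac)
    show "norm (g (f x)) \<le> B"
      using B f(2) by auto
  qed
qed

lemma bounded_lipschitz_closest_point:
  fixes S :: "'b::euclidean_space set"
  assumes "convex S" "compact S" "S \<noteq> {}" and p: "\<And>x y. dist (p x) (p y) \<le> dist x y"
  shows "bounded_lipschitz (\<lambda>x. closest_point S (p x))"
proof -
  have "closed S"
    using \<open>compact S\<close> by (rule compact_imp_closed)
  obtain B where B: "\<And>s. s \<in> S \<Longrightarrow> norm s \<le> B"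
    using compact_imp_bounded[OF \<open>compact S\<close>] unfolding bounded_iff by auto
  show ?thesis
  proof (rule bounded_lipschitzI)
    show "norm (closest_point S (p x) - closest_point S (p y)) \<le> 1 * dist x y" for x y
      using closest_point_lipschitz[OF \<open>convex S\<close> \<open>closed S\<close> \<open>S \<noteq> {}\<close>, of "p x" "p y"] p[of x y]
      by (simp add: dist_norm)
    show "norm (closest_point S (p x)) \<le> B" for x
      by (intro B closest_point_in_set) fact+
  qed
qed

text \<open>The factorial in the bound on successive differences makes the Picard iterates converge
  uniformly on every \<open>{0..b}\<close> at once, so no short-time solutions have to be
  glued.\<close>

lemma picard_lindelof_global:
  fixes F :: "'a::euclidean_space \<Rightarrow> 'a"
  assumes F: "L-lipschitz_on UNIV F"
  obtains x where "x 0 = x0" "\<And>t. 0 \<le> t \<Longrightarrow> (x has_vector_derivative F (x t)) (at t within {0..})"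
proof -
  have "0 \<le> L"
    using F by (rule lipschitz_on_nonneg)
  have contF: "continuous_on UNIV F"
    using F by (rule lipschitz_on_continuous_on)
  define P where "P f t = x0 + integral {0..t} (\<lambda>s. F (f s))" for f :: "real \<Rightarrow> 'a" and t
  define X where "X n = (P ^^ n) (\<lambda>t. x0)" for n
  have X_Suc: "X (Suc n) = P (X n)" for n
    by (simp add: X_def)
  have X_Suc_eq: "X (Suc n) t = x0 + integral {0..t} (\<lambda>s. F (X n s))" for n t
    by (simp add: X_Suc P_def)
  have contP: "continuous_on {0..b} (P f)" if "continuous_on {0..b} f" for f b
  proof -
    have "continuous_on {0..b} (\<lambda>s. F (f s))"
      using that contF continuous_on_compose2 by blast
    then show ?thesis
      unfolding P_def by (intro continuous_intros indefinite_integral_continuous_1 integrable_continuous_interval)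
  qed
  have contX: "continuous_on {0..b} (X n)" for n b
  proof (induction n)
    case 0
    then show ?case by (simp add: X_def)
  next
    case (Suc n)
    then show ?case unfolding X_Suc by (rule contP)
  qed
  have intX: "(\<lambda>s. F (X n s)) integrable_on {0..b}" for n b
    using contX contF continuous_on_compose2 by (intro integrable_continuous_interval) blast
  define M where "M = norm (F x0)"
  have diff_bound: "norm (X (Suc n) t - X n t) \<le> M * L ^ n * t ^ Suc n / fact (Suc n)" if "0 \<le> t" for n t
    using that
  proof (induction n arbitrary: t)
    case 0
    then show ?case
      by (simp add: X_def P_def M_def mult.commute)
  next
    case (Suc n)
    \<comment> \<open>Integrating L times the n-th bound yields the next one: n + 2 is absorbed by
      the factorial, and the value at 0 vanishes.\<close>
    have I: "((\<lambda>s. L * (M * L ^ n * s ^ Suc n / fact (Suc n))) has_integral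
        M * L ^ Suc n * t ^ Suc (Suc n) / fact (Suc (Suc n)) - M * L ^ Suc n * 0 ^ Suc (Suc n) / fact (Suc (Suc n))) {0..t}"
    proof (rule fundamental_theorem_of_calculus)
      show "((\<lambda>s. M * L ^ Suc n * s ^ Suc (Suc n) / fact (Suc (Suc n))) has_vector_derivative
          L * (M * L ^ n * s ^ Suc n / fact (Suc n))) (at s within {0..t})" for s
      proof -
        have "((\<lambda>s. M * L ^ Suc n * s ^ Suc (Suc n) / fact (Suc (Suc n))) has_real_derivative
            M * L ^ Suc n * (real (Suc (Suc n)) * s ^ Suc n) / fact (Suc (Suc n))) (at s within {0..t})"
          using DERIV_pow[of "Suc (Suc n)" s "{0..t}"]
          by (intro DERIV_cdivide DERIV_cmult) (simp del: power_Suc of_nat_Suc)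
        moreover have "M * L ^ Suc n * (real (Suc (Suc n)) * s ^ Suc n) / fact (Suc (Suc n))
            = L * (M * L ^ n * s ^ Suc n / fact (Suc n))"
          by (simp only: fact_Suc[of "Suc n"]) (simp del: fact_Suc of_nat_Suc)
        ultimately show ?thesis
          by (simp only: has_real_derivative_iff_has_vector_derivative)
      qed
    qed (use Suc.prems in auto)
    have "norm (X (Suc (Suc n)) t - X (Suc n) t) = norm (integral {0..t} (\<lambda>s. F (X (Suc n) s) - F (X n s)))"
      by (simp only: integral_diff[OF intX intX] X_Suc_eq[of "Suc n" t] X_Suc_eq[of n t]) simp
    also have "\<dots> \<le> integral {0..t} (\<lambda>s. L * (M * L ^ n * s ^ Suc n / fact (Suc n)))"
    proof (rule integral_norm_bound_integral)
      show "(\<lambda>s. F (X (Suc n) s) - F (X n s)) integrable_on {0..t}"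
        by (intro integrable_diff intX)
      show "(\<lambda>s. L * (M * L ^ n * s ^ Suc n / fact (Suc n))) integrable_on {0..t}"
        by (intro integrable_continuous_interval continuous_intros) auto
      fix s assume "s \<in> {0..t}"
      have "norm (F (X (Suc n) s) - F (X n s)) \<le> L * norm (X (Suc n) s - X n s)"
        using lipschitz_onD[OF F] by (simp add: dist_norm)
      also have "\<dots> \<le> L * (M * L ^ n * s ^ Suc n / fact (Suc n))"
        using Suc.IH[of s] \<open>s \<in> {0..t}\<close> \<open>0 \<le> L\<close> by (intro mult_left_mono) auto
      finally show "norm (F (X (Suc n) s) - F (X n s)) \<le> L * (M * L ^ n * s ^ Suc n / fact (Suc n))" .
    qed
    also have "\<dots> = M * L ^ Suc n * t ^ Suc (Suc n) / fact (Suc (Suc n))"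
      unfolding integral_unique[OF I] by simp
    finally show ?case .
  qed
  define x where "x t = x0 + (\<Sum>n. X (Suc n) t - X n t)" for t
  have X_sum: "X n t = x0 + (\<Sum>k<n. X (Suc k) t - X k t)" for n t
    by (induction n) (auto simp: X_def[of 0] algebra_simps)
  have unif: "uniform_limit {0..b} X x sequentially" if "0 \<le> b" for b
  proof -
    have "summable (\<lambda>n. M * L ^ n * b ^ Suc n / fact (Suc n))"
    proof -
      have "summable (\<lambda>n. (L * b) ^ n / fact n)"
        using summable_exp[of "L * b"] by (simp add: field_simps)
      then have "summable (\<lambda>n. M * b * ((L * b) ^ n / fact n))"
        by (rule summable_mult)
      then show ?thesis
      proof (rule summable_comparison_test')
        fix n :: nat
        have "(fact n :: real) \<le> fact (Suc n)"
          by (rule fact_mono) auto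
        then have "(M * b) * (L * b) ^ n / fact (Suc n) \<le> (M * b) * (L * b) ^ n / fact n"
          using that \<open>0 \<le> L\<close> by (intro divide_left_mono mult_nonneg_nonneg) (auto simp: M_def)
        then show "norm (M * L ^ n * b ^ Suc n / fact (Suc n)) \<le> M * b * ((L * b) ^ n / fact n)"
          using that \<open>0 \<le> L\<close> by (simp add: M_def power_mult_distrib mult_ac del: fact_Suc)
      qed
    qed
    then have "uniform_limit {0..b} (\<lambda>n t. \<Sum>k<n. X (Suc k) t - X k t) (\<lambda>t. \<Sum>k. X (Suc k) t - X k t) sequentially"
    proof (rule Weierstrass_m_test[rotated])
      fix n t assume t: "t \<in> {0..b}"
      have "norm (X (Suc n) t - X n t) \<le> M * L ^ n * t ^ Suc n / fact (Suc n)"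
        using t by (intro diff_bound) auto
      also have "\<dots> \<le> M * L ^ n * b ^ Suc n / fact (Suc n)"
        using t \<open>0 \<le> L\<close> by (intro divide_right_mono mult_left_mono power_mono) (auto simp: M_def)
      finally show "norm (X (Suc n) t - X n t) \<le> M * L ^ n * b ^ Suc n / fact (Suc n)" .
    qed
    then have "uniform_limit {0..b} (\<lambda>n t. x0 + (\<Sum>k<n. X (Suc k) t - X k t)) x sequentially"
      unfolding x_def by (intro uniform_limit_intros)
    then show ?thesis
      unfolding X_sum[symmetric] .
  qed
  have contx: "continuous_on {0..b} x" if "0 \<le> b" for b
    by (rule uniform_limit_theorem[OF _ unif[OF that]]) (use contX in simp_all)
  have fixed: "x t = P x t" if "0 \<le> t" for t
  proof (rule LIMSEQ_unique)
    show "(\<lambda>n. X (Suc n) t) \<longlonglongrightarrow> x t"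
      using tendsto_uniform_limitI[OF unif[OF that], of t] that by (auto intro: LIMSEQ_Suc)
    \<comment> \<open>Uniform convergence passes through F and the integral, so the limit solves the
      integral equation.\<close>
    have unifF: "uniform_limit {0..t} (\<lambda>n s. F (X n s)) (\<lambda>s. F (x s)) sequentially"
      by (rule uniform_limit_compose_uniformly_continuous_on
          [OF unif[OF that] lipschitz_on_uniformly_continuous[OF F]]) auto
    have "continuous_on {0..t} (\<lambda>s. F (X n s))" for n
      using contX contF continuous_on_compose2 by blast
    then obtain I J where IJ: "\<And>n. ((\<lambda>s. F (X n s)) has_integral I n) {0..t}"
        "((\<lambda>s. F (x s)) has_integral J) {0..t}" "I \<longlonglongrightarrow> J"
      by (rule uniform_limit_integral[OF unifF]) auto
    from IJ(3) have "(\<lambda>n. integral {0..t} (\<lambda>s. F (X n s))) \<longlonglongrightarrow> integral {0..t} (\<lambda>s. F (x s))"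
      by (simp add: IJ(1)[THEN integral_unique] IJ(2)[THEN integral_unique])
    then show "(\<lambda>n. X (Suc n) t) \<longlonglongrightarrow> P x t"
      unfolding X_Suc P_def by (intro tendsto_intros)
  qed
  show ?thesis
  proof
    show "x 0 = x0"
      using fixed[of 0] by (simp add: P_def)
    fix t :: real assume t: "0 \<le> t"
    have "continuous_on {0..t+1} (\<lambda>s. F (x s))"
      using contx[of "t+1"] t contF continuous_on_compose2 by fastforce
    then have "((\<lambda>t. integral {0..t} (\<lambda>s. F (x s))) has_vector_derivative F (x t)) (at t within {0..t+1})"
      using t by (intro integral_has_vector_derivative) auto
    then have "(P x has_vector_derivative F (x t)) (at t within {0..t+1})"
      unfolding P_def by (auto intro!: derivative_eq_intros)
    then have "(x has_vector_derivative F (x t)) (at t within {0..t+1})"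
      by (rule has_vector_derivative_transform[rotated 2]) (use t fixed in auto)
    \<comment> \<open>\<open>{0..t+1}\<close> and \<open>{0..}\<close> coincide on a neighbourhood
      of t.\<close>
    moreover have "at t within {0..t+1} = at t within {0..}"
      by (rule at_within_nhd[of _ "{..<t+1}"]) auto
    ultimately show "(x has_vector_derivative F (x t)) (at t within {0..})"
      by simp
  qed
qed

section \<open>Solutions of the truncated equation\<close>

text \<open>The components are first-order directional derivatives, bounded by (U); the second-order
  bound along unit vectors, extended by homogeneity, bounds the operator norm of their derivatives.
  The factor 3 comes from the l1 estimate.\<close>

lemma bounded_lipschitz_grad:
  assumes "cond_U V"
  shows "bounded_lipschitz (grad V)"
proof -
  from assms obtain B where B: "\<And>vs x. length vs \<le> 3 \<Longrightarrow> (\<And>v. v \<in> set vs \<Longrightarrow> norm v = 1) \<Longrightarrow> \<bar>dderiv vs V x\<bar> \<le> B"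
    unfolding cond_U_def by blast
  have "0 \<le> B"
    using B[of "[]" 0] by (auto intro: order_trans[rotated])
  define g where "g i = dderiv [axis i 1] V" for i :: 3
  have g: "grad V x $ i = g i x" for x i
    by (simp add: grad_def g_def dderiv_def)
  have g_bound: "\<bar>g i x\<bar> \<le> B" for i x
    unfolding g_def by (rule B) (auto simp: norm_axis_1)
  have g_lip: "\<bar>g i x - g i y\<bar> \<le> B * dist x y" for i x y
  proof -
    have diff: "g i differentiable (at z)" for z
      using assms unfolding cond_U_def Ck_fun_def g_def by auto
    have onorm: "onorm (frechet_derivative (g i) (at z)) \<le> B" for z
    proof (rule onorm_bound[OF \<open>0 \<le> B\<close>])
      interpret bounded_linear "frechet_derivative (g i) (at z)"
        using diff by (meson frechet_derivative_works has_derivative_bounded_linear)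
      fix v :: vec3
      show "norm (frechet_derivative (g i) (at z) v) \<le> B * norm v"
      proof (cases "v = 0")
        case False
        define e where "e = inverse (norm v) *\<^sub>R v"
        have e: "norm e = 1" "v = norm v *\<^sub>R e"
          using False by (auto simp: e_def)
        \<comment> \<open>The head of the list is the outermost derivative, so this is the
          derivative of \<open>g i\<close> in direction e.\<close>
        have "\<bar>dderiv [e, axis i 1] V z\<bar> \<le> B"
          by (rule B) (auto simp: norm_axis_1 e(1))
        then have "\<bar>frechet_derivative (g i) (at z) e\<bar> \<le> B"
          by (simp add: g_def dderiv_def)
        then have "norm v * \<bar>frechet_derivative (g i) (at z) e\<bar> \<le> norm v * B"
          by (intro mult_left_mono) auto
        moreover have "frechet_derivative (g i) (at z) v = norm v * frechet_derivative (g i) (at z) e"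
          using scaleR[of "norm v" e] e(2) by simp
        ultimately show ?thesis
          by (simp add: abs_mult mult.commute)
      qed (simp add: zero)
    qed
    have "norm (g i x - g i y) \<le> B * norm (x - y)"
      using diff frechet_derivative_works onorm
      by (intro differentiable_bound[of UNIV "g i" "\<lambda>z. frechet_derivative (g i) (at z)"]) auto
    then show ?thesis
      by (simp add: dist_norm)
  qed
  show ?thesis
  proof (rule bounded_lipschitzI)
    fix x y
    have "norm (grad V x - grad V y) \<le> (\<Sum>i\<in>UNIV. \<bar>(grad V x - grad V y) $ i\<bar>)"
      by (rule norm_le_l1_cart)
    also have "\<dots> \<le> (\<Sum>i\<in>(UNIV::3 set). B * dist x y)"
      using g_lip by (intro sum_mono) (simp add: g)
    finally show "norm (grad V x - grad V y) \<le> (3 * B) * dist x y"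
      by simp
    have "norm (grad V x) \<le> (\<Sum>i\<in>UNIV. \<bar>grad V x $ i\<bar>)"
      by (rule norm_le_l1_cart)
    also have "\<dots> \<le> (\<Sum>i\<in>(UNIV::3 set). B)"
      using g_bound by (intro sum_mono) (simp add: g)
    finally show "norm (grad V x) \<le> 3 * B"
      by simp
  qed
qed

text \<open>Sherman--Morrison inverse of the rank-one perturbation \<open>acoef \<rho> u\<close> of the identity.\<close>

definition acoef_inv :: "(vec3 \<Rightarrow> real) \<Rightarrow> vec3 \<Rightarrow> vec3 \<Rightarrow> vec3" where
  "acoef_inv \<rho> u v = inverse (rad_coeff \<rho>) *\<^sub>R
     ((1 - u \<bullet> u)\<^sup>2 *\<^sub>R (v - (4 * inverse (1 + 3 * (u \<bullet> u)) * (u \<bullet> v)) *\<^sub>R u))"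

lemma acoef_acoef_inv:
  assumes "norm u < 1" "charge \<rho> \<noteq> 0"
  shows "acoef \<rho> u (acoef_inv \<rho> u v) = v"
proof -
  define x where "x = u \<bullet> u"
  define p where "p = u \<bullet> v"
  \<comment> \<open>4/(1+3x) is k/(1+kx) for k = 4/(1-x), the relative strength of the rank-one part
    of \<open>acoef\<close>.\<close>
  define c where "c = 4 * inverse (1 + 3 * x) * p"
  have x: "0 \<le> x" "x < 1"
    using norm_sq_less_1[OF assms(1)] by (auto simp: x_def)
  have c: "c * (1 + 3 * x) = 4 * p"
    using x by (simp add: c_def)
  define k where "k = rad_coeff \<rho>"
  have k: "k \<noteq> 0"
    using assms(2) by (simp add: k_def rad_coeff_def)
  have inv: "acoef_inv \<rho> u v = inverse k *\<^sub>R ((1 - x)\<^sup>2 *\<^sub>R (v - c *\<^sub>R u))"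
    by (simp add: acoef_inv_def k_def x_def p_def c_def)
  have inner: "u \<bullet> acoef_inv \<rho> u v = inverse k * ((1 - x)\<^sup>2 * (p - c * x))"
    unfolding inv by (simp add: inner_diff_right x_def p_def)
  have w2: "inverse (1 - x) ^ 2 * (1 - x)\<^sup>2 = 1"
    using x by (simp add: power_mult_distrib[symmetric])
  then have w3: "inverse (1 - x) ^ 3 * (1 - x)\<^sup>2 = inverse (1 - x)"
    by (simp add: power3_eq_cube power2_eq_square mult_ac)
  have "4 * (p - c * x) = c * (1 - x)"
    using c by (simp add: algebra_simps)
  then have 4: "4 * inverse (1 - x) * (p - c * x) = c"
    using x by (simp add: field_simps)
  have "acoef \<rho> u (acoef_inv \<rho> u v) =
      k *\<^sub>R (inverse (1 - x) ^ 2 *\<^sub>R acoef_inv \<rho> u v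
        + (4 * inverse (1 - x) ^ 3 * (inverse k * ((1 - x)\<^sup>2 * (p - c * x)))) *\<^sub>R u)"
    unfolding acoef_eq[OF assms(1)] inner by (simp add: k_def x_def)
  also have "\<dots> = (k * inverse k) *\<^sub>R ((inverse (1 - x) ^ 2 * (1 - x)\<^sup>2) *\<^sub>R (v - c *\<^sub>R u)
        + (4 * (inverse (1 - x) ^ 3 * (1 - x)\<^sup>2) * (p - c * x)) *\<^sub>R u)"
    unfolding inv by (simp add: scaleR_add_right scaleR_diff_right mult_ac)
  also have "\<dots> = v"
    using k unfolding w2 w3 4 by simp
  finally show ?thesis .
qed

section \<open>The effective equation solved for its highest derivative\<close>

definition acceleration ::
  "(vec3 \<Rightarrow> real) \<Rightarrow> real \<Rightarrow> vec3 \<Rightarrow> vec3 \<Rightarrow> vec3 \<Rightarrow> vec3" where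
  "acceleration \<rho> \<epsilon> g u y = inverse \<epsilon> *\<^sub>R acoef_inv \<rho> u (mass \<rho> u y + g - \<epsilon> *\<^sub>R bcoef \<rho> u y)"

lemma effective_equation_acceleration:
  assumes "norm u < 1" "charge \<rho> \<noteq> 0" "\<epsilon> \<noteq> 0"
  shows "mass \<rho> u y = - g + \<epsilon> *\<^sub>R acoef \<rho> u (acceleration \<rho> \<epsilon> g u y) + \<epsilon> *\<^sub>R bcoef \<rho> u y"
proof -
  have "acoef \<rho> u (c *\<^sub>R w) = c *\<^sub>R acoef \<rho> u w" for c w
    by (simp add: acoef_def scaleR_add_right mult_ac)
  then show ?thesis
    using assms by (simp add: acceleration_def acoef_acoef_inv)
qed

text \<open>All coefficients are polynomial in U, Y, G and five functions of |U|^2, which stays in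
  \<open>{0..\<sigma>\<^sup>2}\<close>, away from 1. The power series is essential: through |u| the
  mass would not be visibly Lipschitz at u = 0.\<close>

lemma bounded_lipschitz_acceleration:
  fixes U Y G :: "'a::metric_space \<Rightarrow> vec3"
  assumes U: "bounded_lipschitz U" "\<And>x. norm (U x) \<le> \<sigma>" and "\<sigma> < 1"
    and Y: "bounded_lipschitz Y" and G: "bounded_lipschitz G"
  shows "bounded_lipschitz (\<lambda>x. acceleration \<rho> \<epsilon> (G x) (U x) (Y x))"
proof -
  have n: "norm (U x) < 1" for x
    using U(2)[of x] \<open>\<sigma> < 1\<close> by simp
  have "0 \<le> \<sigma>"
    using U(2) norm_ge_zero order_trans by blast
  have \<sigma>: "\<sigma>\<^sup>2 < 1"
    using \<open>0 \<le> \<sigma>\<close> \<open>\<sigma> < 1\<close> by (simp add: power_less_one_iff)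
  define S where "S x = U x \<bullet> U x" for x
  have S: "S x \<in> {0..\<sigma>\<^sup>2}" for x
    using U(2) by (simp add: S_def dot_square_norm power_mono)
  have lipS: "bounded_lipschitz S"
    unfolding S_def by (intro bounded_lipschitz_inner U)
  have 1: "bounded_lipschitz (\<lambda>x. inverse (1 - S x))"
    by (rule bounded_lipschitz_compose_deriv[OF lipS S, where g = "\<lambda>s. inverse (1 - s)" and g' = "\<lambda>s. inverse (1 - s) ^ 2"])
       (use \<sigma> in \<open>auto intro!: derivative_eq_intros continuous_intros simp: power2_eq_square\<close>)
  have 2: "bounded_lipschitz (\<lambda>x. inverse (1 + 3 * S x))"
    by (rule bounded_lipschitz_compose_deriv[OF lipS S, where g = "\<lambda>s. inverse (1 + 3 * s)" and g' = "\<lambda>s. - 3 * inverse (1 + 3 * s) ^ 2"])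
       (auto intro!: derivative_eq_intros continuous_intros simp: power2_eq_square)
  have 3: "bounded_lipschitz (\<lambda>x. inverse (sqrt (1 - S x)))"
  proof -
    have lip: "bounded_lipschitz (\<lambda>x. 1 - S x)"
      by (intro bounded_lipschitz_diff bounded_lipschitz_const lipS)
    have range: "1 - S x \<in> {1 - \<sigma>\<^sup>2..1}" for x
      using S[of x] by auto
    show ?thesis
      by (rule bounded_lipschitz_compose_deriv[OF lip range,
            where g = "\<lambda>s. inverse (sqrt s)" and g' = "\<lambda>s. - (inverse (sqrt s) / 2 * (inverse (sqrt s) * inverse (sqrt s)))"])
         (use \<sigma> in \<open>auto intro!: derivative_eq_intros continuous_intros\<close>)
  qed
  have 4: "bounded_lipschitz (\<lambda>x. phi_series (S x))"
  proof (rule bounded_lipschitz_compose_deriv[OF lipS S])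
    show "(phi_series has_real_derivative phi_series' s) (at s)" if "s \<in> {0..\<sigma>\<^sup>2}" for s
      using that \<sigma> by (intro phi_series_deriv) auto
    show "continuous_on {0..\<sigma>\<^sup>2} phi_series'"
      using \<sigma> by (intro continuous_at_imp_continuous_on ballI DERIV_isCont[OF phi_series'_deriv]) auto
  qed
  have 5: "bounded_lipschitz (\<lambda>x. phi_series' (S x))"
  proof (rule bounded_lipschitz_compose_deriv[OF lipS S])
    show "(phi_series' has_real_derivative phi_series'' s) (at s)" if "s \<in> {0..\<sigma>\<^sup>2}" for s
      using that \<sigma> by (intro phi_series'_deriv) auto
    show "continuous_on {0..\<sigma>\<^sup>2} phi_series''"
      using \<sigma> by (intro continuous_at_imp_continuous_on ballI isCont_phi_series'') auto
  qed
  note intros = bounded_lipschitz_add bounded_lipschitz_diff bounded_lipschitz_scaleR bounded_lipschitz_mult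
    bounded_lipschitz_inner bounded_lipschitz_power bounded_lipschitz_const U(1) Y G lipS 1 2 3 4 5
  have m: "bounded_lipschitz (\<lambda>x. mass \<rho> (U x) (Y x))"
    unfolding mass_def m0_def mf_eq[OF n] lorentz_def power2_norm_eq_inner S_def[symmetric] inverse_eq_divide[symmetric]
    by (intro intros)
  have b: "bounded_lipschitz (\<lambda>x. bcoef \<rho> (U x) (Y x))"
    unfolding bcoef_eq[OF n] S_def[symmetric] by (intro intros)
  show ?thesis
    unfolding acceleration_def acoef_inv_def S_def[symmetric]
    by (intro intros m b)
qed

text \<open>Composing the vector field with the nearest-point projections onto \<open>cball 0 \<sigma>\<close> and
  \<open>cball 0 R\<close> makes it globally Lipschitz without changing it where it matters.\<close>

lemma truncated_solution_exists:
  assumes U: "cond_U V" and "charge \<rho> \<noteq> 0" "\<epsilon> \<noteq> 0" "0 \<le> \<sigma>" "\<sigma> < 1" "0 \<le> R"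
  obtains r u y where "r 0 = r0" "u 0 = u0" "y 0 = y0"
    "continuous_on {0..} u" "continuous_on {0..} y"
    "\<forall>I\<subseteq>{0..}. (\<forall>t\<in>I. norm (u t) \<le> \<sigma> \<and> norm (y t) \<le> R)
       \<longrightarrow> effective_solution \<rho> V \<epsilon> I r u y"
proof -
  define PU where "PU x = closest_point (cball 0 \<sigma>) (fst (snd x))" for x :: "vec3 \<times> vec3 \<times> vec3"
  define PY where "PY x = closest_point (cball 0 R) (snd (snd x))" for x :: "vec3 \<times> vec3 \<times> vec3"
  define G where "G x = grad V (fst x)" for x :: "vec3 \<times> vec3 \<times> vec3"
  define F where "F x = (PU x, PY x, acceleration \<rho> \<epsilon> (G x) (PU x) (PY x))" for x
  have U': "bounded_lipschitz PU"
    unfolding PU_def using \<open>0 \<le> \<sigma>\<close>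
    by (intro bounded_lipschitz_closest_point) (auto intro: order_trans[OF dist_fst_le dist_snd_le])
  have Y': "bounded_lipschitz PY"
    unfolding PY_def using \<open>0 \<le> R\<close>
    by (intro bounded_lipschitz_closest_point) (auto intro: order_trans[OF dist_snd_le dist_snd_le])
  have G': "bounded_lipschitz G"
  proof -
    obtain L B where L: "0 \<le> L" "\<And>x y. norm (grad V x - grad V y) \<le> L * dist x y" "\<And>x. norm (grad V x) \<le> B"
      using bounded_lipschitz_grad[OF U] by (rule bounded_lipschitzE) blast
    show ?thesis
    proof (rule bounded_lipschitzI)
      show "norm (G x - G y) \<le> L * dist x y" for x y
        unfolding G_def using L(2)[of "fst x" "fst y"] mult_left_mono[OF dist_fst_le[of x y] L(1)]
        by linarith
      show "norm (G x) \<le> B" for x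
        unfolding G_def by (rule L(3))
    qed
  qed
  have "norm (PU x) \<le> \<sigma>" for x
    using closest_point_in_set[of "cball 0 \<sigma>" "fst (snd x)"] \<open>0 \<le> \<sigma>\<close> by (simp add: PU_def)
  then have A': "bounded_lipschitz (\<lambda>x. acceleration \<rho> \<epsilon> (G x) (PU x) (PY x))"
    using U' Y' G' \<open>\<sigma> < 1\<close> by (intro bounded_lipschitz_acceleration)
  obtain L where L: "L-lipschitz_on UNIV F"
  proof -
    obtain L1 L2 L3 where "L1-lipschitz_on UNIV PU" "L2-lipschitz_on UNIV PY"
        "L3-lipschitz_on UNIV (\<lambda>x. acceleration \<rho> \<epsilon> (G x) (PU x) (PY x))"
      using U' Y' A' unfolding bounded_lipschitz_def by blast
    from lipschitz_on_Pair[OF this(1) lipschitz_on_Pair[OF this(2,3)]] show ?thesis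
      using that unfolding F_def by blast
  qed
  obtain x where x0: "x 0 = (r0, u0, y0)"
    and x: "\<And>t. 0 \<le> t \<Longrightarrow> (x has_vector_derivative F (x t)) (at t within {0..})"
    using picard_lindelof_global[OF L] by blast
  define r u y where "r = (\<lambda>t. fst (x t))" and "u = (\<lambda>t. fst (snd (x t)))" and "y = (\<lambda>t. snd (snd (x t)))"
  have r': "(r has_vector_derivative PU (x t)) (at t within {0..})"
    and u': "(u has_vector_derivative PY (x t)) (at t within {0..})"
    and y': "(y has_vector_derivative acceleration \<rho> \<epsilon> (G (x t)) (PU (x t)) (PY (x t))) (at t within {0..})"
    if "0 \<le> t" for t
    using bounded_linear.has_vector_derivative[OF bounded_linear_fst x[OF that]]
      bounded_linear.has_vector_derivative[OF bounded_linear_fst_comp[OF bounded_linear_snd] x[OF that]]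
      bounded_linear.has_vector_derivative[OF bounded_linear_snd_comp[OF bounded_linear_snd] x[OF that]]
    by (simp_all add: F_def r_def u_def y_def)
  show ?thesis
  proof
    show "r 0 = r0" "u 0 = u0" "y 0 = y0"
      by (simp_all add: r_def u_def y_def x0)
    show "continuous_on {0..} u" "continuous_on {0..} y"
      using u' y' has_vector_derivative_continuous by (force simp: continuous_on_eq_continuous_within)+
    \<comment> \<open>I is arbitrary since this is applied to initial segments
      \<open>{0..<t}\<close> during continuation and to \<open>{0..}\<close> at the end.\<close>
    have "effective_solution \<rho> V \<epsilon> I r u y"
      if I: "I \<subseteq> {0..}" and bound: "\<And>t. t \<in> I \<Longrightarrow> norm (u t) \<le> \<sigma> \<and> norm (y t) \<le> R" for I
      unfolding effective_solution_def is_solution_def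
    proof (intro ballI conjI exI)
      fix t assume "t \<in> I"
      then have "0 \<le> t"
        using I by auto
      have PU: "PU (x t) = u t" and PY: "PY (x t) = y t"
        using bound[OF \<open>t \<in> I\<close>] by (auto simp: PU_def PY_def u_def y_def intro!: closest_point_self)
      show n: "norm (u t) < 1"
        using bound[OF \<open>t \<in> I\<close>] \<open>\<sigma> < 1\<close> by simp
      note sub = has_vector_derivative_within_subset[OF _ I]
      show "(r has_vector_derivative u t) (at t within I)"
        using sub[OF r'[OF \<open>0 \<le> t\<close>]] by (simp add: PU)
      show "(u has_vector_derivative y t) (at t within I)"
        using sub[OF u'[OF \<open>0 \<le> t\<close>]] by (simp add: PY)
      show "(y has_vector_derivative acceleration \<rho> \<epsilon> (grad V (r t)) (u t) (y t)) (at t within I)"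
        using sub[OF y'[OF \<open>0 \<le> t\<close>]] by (simp add: PU PY G_def r_def)
      show "mass \<rho> (u t) (y t) = - grad V (r t)
          + \<epsilon> *\<^sub>R acoef \<rho> (u t) (acceleration \<rho> \<epsilon> (grad V (r t)) (u t) (y t)) + \<epsilon> *\<^sub>R bcoef \<rho> (u t) (y t)"
        using n assms by (intro effective_equation_acceleration)
    qed
    then show "\<forall>I\<subseteq>{0..}. (\<forall>t\<in>I. norm (u t) \<le> \<sigma> \<and> norm (y t) \<le> R)
       \<longrightarrow> effective_solution \<rho> V \<epsilon> I r u y"
      by blast
  qed
qed

section \<open>Confinement\<close>

lemma effective_solution_subset:
  assumes "effective_solution \<rho> V \<epsilon> J r u y" "I \<subseteq> J"
  shows "effective_solution \<rho> V \<epsilon> I r u y"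
  unfolding effective_solution_def is_solution_def
proof
  fix t assume "t \<in> I"
  then have "t \<in> J"
    using assms(2) by blast
  note sub = has_vector_derivative_within_subset[OF _ assms(2)]
  from assms(1) \<open>t \<in> J\<close> obtain z where "norm (u t) < 1"
      "(r has_vector_derivative u t) (at t within J)"
      "(u has_vector_derivative y t) (at t within J)"
      "(y has_vector_derivative z) (at t within J)"
      "mass \<rho> (u t) (y t) = - grad V (r t) + \<epsilon> *\<^sub>R acoef \<rho> (u t) z + \<epsilon> *\<^sub>R bcoef \<rho> (u t) (y t)"
    unfolding effective_solution_def is_solution_def by blast
  then show "norm (u t) < 1 \<and> (r has_vector_derivative u t) (at t within I) \<and>
      (u has_vector_derivative y t) (at t within I) \<and>
      (\<exists>z. (y has_vector_derivative z) (at t within I) \<and>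
         mass \<rho> (u t) (y t) = - grad V (r t) + \<epsilon> *\<^sub>R acoef \<rho> (u t) z + \<epsilon> *\<^sub>R bcoef \<rho> (u t) (y t))"
    by (intro conjI exI[of _ z] sub)
qed

lemma effective_solution_continuous:
  assumes "effective_solution \<rho> V \<epsilon> I r u y"
  shows "continuous_on I u"
  unfolding continuous_on_eq_continuous_within
proof
  fix t assume "t \<in> I"
  with assms have "(u has_vector_derivative y t) (at t within I)"
    by (simp add: effective_solution_def is_solution_def)
  then show "continuous (at t within I) u"
    by (rule has_vector_derivative_continuous)
qed

lemma modified_solution_iff_effective:
  assumes "\<And>t. t \<in> I \<Longrightarrow> norm (u t) \<le> 1 - \<delta>"
  shows "modified_solution \<rho> V \<delta> \<epsilon> I r u y \<longleftrightarrow> effective_solution \<rho> V \<epsilon> I r u y"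
  unfolding modified_solution_def effective_solution_def is_solution_def
  by (intro ball_cong refl) (simp add: cutoff_def assms)

text \<open>Only weak bounds survive the limit at the end point; strictness is recovered from the
  gaps \<open>s0\<close> < \<sigma> and C < C + 1.\<close>

lemma norm_le_at_right_end:
  fixes f :: "real \<Rightarrow> 'a::real_normed_vector"
  assumes "continuous_on {0..t} f" "0 < t" "\<And>s. s \<in> {0..<t} \<Longrightarrow> norm (f s) \<le> c"
  shows "norm (f t) \<le> c"
proof (rule continuous_le_on_closure[of "{0..<t}" "\<lambda>s. norm (f s)"])
  show "continuous_on (closure {0..<t}) (\<lambda>s. norm (f s))"
    using assms(1,2) by (simp add: continuous_on_norm)
qed (use assms in auto)

theorem theorem4p4:
  fixes V \<rho> :: "vec3 \<Rightarrow> real" and vbar c0 \<epsilon>0 C :: real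
  assumes U: "cond_U V"
    and rho: "admissible_rho \<rho>" and charge_nz: "charge \<rho> \<noteq> 0"
    and vbar: "vbar < 1"
    and c0: "\<forall>r u. norm u \<le> vbar \<longrightarrow> Ham \<rho> V r u \<le> c0"
    and eps0: "\<epsilon>0 > 0"
  shows "\<exists>\<epsilon>1>0. \<epsilon>1 \<le> \<epsilon>0 \<and>
    (\<forall>h :: real \<Rightarrow> vec3 \<Rightarrow> vec3 \<Rightarrow> vec3.
       (\<forall>\<epsilon>. 0 < \<epsilon> \<and> \<epsilon> \<le> \<epsilon>0 \<longrightarrow>
          C1_on (\<lambda>(r, u). h \<epsilon> r u) {(r, u). norm u < 1} \<and>
          (\<forall>r u. norm u < 1 \<longrightarrow> norm (h \<epsilon> r u) \<le> C) \<and>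
          (\<forall>T r u y. modified_solution \<rho> V (delta_bar \<rho> V vbar c0) \<epsilon> {0..<T} r u y \<and>
               y 0 = h \<epsilon> (r 0) (u 0) \<longrightarrow> (\<forall>t\<in>{0..<T}. y t = h \<epsilon> (r t) (u t))))
       \<longrightarrow>
       (\<forall>\<epsilon>. 0 < \<epsilon> \<and> \<epsilon> \<le> \<epsilon>1 \<longrightarrow>
          (\<forall>T r u y. effective_solution \<rho> V \<epsilon> {0..<T} r u y \<and>
               norm (u 0) \<le> vbar \<and> y 0 = h \<epsilon> (r 0) (u 0) \<longrightarrow>
               (\<forall>t\<in>{0..<T}. \<not> (norm (u t) = 1 - delta_bar \<rho> V vbar c0 \<and>
                                  y t = h \<epsilon> (r t) (u t)))) \<and>
          (\<forall>r0 u0. norm u0 \<le> vbar \<longrightarrow>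
             (\<exists>r u y. effective_solution \<rho> V \<epsilon> {0..} r u y \<and>
                r 0 = r0 \<and> u 0 = u0 \<and> y 0 = h \<epsilon> r0 u0))))"
\<comment> \<open>For negative \<open>vbar\<close> there is no admissible initial velocity, and both
  claims are vacuous.\<close>
proof (cases "0 \<le> vbar")
  case False
  then have empty: "norm v \<le> vbar \<Longrightarrow> P" for v :: vec3 and P
    using norm_ge_zero[of v] by linarith
  show ?thesis
    by (intro exI[of _ \<epsilon>0] conjI allI impI eps0 order_refl; (elim conjE)?; erule empty)
next
  case True
  define \<delta> where "\<delta> = delta_bar \<rho> V vbar c0"
  define \<sigma> where "\<sigma> = 1 - \<delta>"
  have diff: "V differentiable at x" for x
  proof -
    have "\<forall>vs. length vs < 3 \<longrightarrow> (\<forall>x. dderiv vs V differentiable (at x))"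
      using U unfolding cond_U_def Ck_fun_def by blast
    from this[rule_format, of "[]" x] show ?thesis
      by (simp add: dderiv_def)
  qed
  have bdd: "bdd_below (range V)"
    using U by (simp add: cond_U_def)
  \<comment> \<open>The rest state witnesses that the sublevel set defining \<open>s0\<close> is
    nonempty.\<close>
  have "Ham \<rho> V 0 0 \<le> c0 + 1"
    using c0[rule_format, of 0 0] True by simp
  note s0 = s0_bounds[OF bdd _ this, simplified]
  \<comment> \<open>By the two halves in \<open>delta_bar\<close>, \<sigma> is the larger of the
    midpoints between \<open>vbar\<close> and 1 and between \<open>s0\<close> and 1.\<close>
  have \<sigma>: "0 \<le> \<sigma>" "\<sigma> < 1" "vbar < \<sigma>" "s0 \<rho> V c0 < \<sigma>"
    using vbar s0(1) True by (auto simp: \<sigma>_def \<delta>_def delta_bar_def min_def field_simps)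
  have "\<sigma>\<^sup>2 < 1"
    using \<sigma> by (simp add: power_less_one_iff)
  \<comment> \<open>\<epsilon> K \<le> 1 is the smallness condition of \<open>Ham_bound\<close>. K
    is fixed before h, when C is not yet known to be nonnegative, hence the absolute value; K + 1
    below avoids division by zero.\<close>
  define K where "K = 2 * rad_coeff \<rho> * rad_weight (\<sigma>\<^sup>2) * \<bar>C\<bar>"
  have "0 \<le> K"
    unfolding K_def using rad_coeff_nonneg[of \<rho>] rad_weight_mono(1)[of "\<sigma>\<^sup>2" "\<sigma>\<^sup>2"] \<open>\<sigma>\<^sup>2 < 1\<close> by simp
  define \<epsilon>1 where "\<epsilon>1 = min \<epsilon>0 (1 / (K + 1))"
  have \<epsilon>1: "0 < \<epsilon>1" "\<epsilon>1 \<le> \<epsilon>0"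
    using eps0 \<open>0 \<le> K\<close> by (auto simp: \<epsilon>1_def)
  have small: "\<epsilon> * K \<le> 1" if "0 < \<epsilon>" "\<epsilon> \<le> \<epsilon>1" for \<epsilon>
  proof -
    have "\<epsilon> * K \<le> 1 / (K + 1) * K"
      using that \<open>0 \<le> K\<close> by (intro mult_right_mono) (auto simp: \<epsilon>1_def)
    also have "\<dots> \<le> 1"
      using \<open>0 \<le> K\<close> by (simp add: field_simps)
    finally show ?thesis .
  qed
  show ?thesis
    unfolding \<delta>_def[symmetric]
  proof (intro exI[of _ \<epsilon>1] conjI allI impI \<epsilon>1)
    fix h :: "real \<Rightarrow> vec3 \<Rightarrow> vec3 \<Rightarrow> vec3" and \<epsilon> :: real
    assume h: "\<forall>\<epsilon>. 0 < \<epsilon> \<and> \<epsilon> \<le> \<epsilon>0 \<longrightarrow>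
          C1_on (\<lambda>(r, u). h \<epsilon> r u) {(r, u). norm u < 1} \<and>
          (\<forall>r u. norm u < 1 \<longrightarrow> norm (h \<epsilon> r u) \<le> C) \<and>
          (\<forall>T r u y. modified_solution \<rho> V \<delta> \<epsilon> {0..<T} r u y \<and>
               y 0 = h \<epsilon> (r 0) (u 0) \<longrightarrow> (\<forall>t\<in>{0..<T}. y t = h \<epsilon> (r t) (u t)))"
      and \<epsilon>': "0 < \<epsilon> \<and> \<epsilon> \<le> \<epsilon>1"
    from \<epsilon>' have \<epsilon>: "0 < \<epsilon>" "\<epsilon> \<le> \<epsilon>1" "\<epsilon> \<le> \<epsilon>0"
      using \<epsilon>1 by auto
    note h\<epsilon> = h[THEN spec, THEN mp, OF conjI[OF \<epsilon>(1,3)], THEN conjunct2]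
    have h_bound: "norm (h \<epsilon> r u) \<le> C" if "norm u < 1" for r u
      using h\<epsilon>[THEN conjunct1] that by blast
    have invariant: "y t = h \<epsilon> (r t) (u t)"
      if "modified_solution \<rho> V \<delta> \<epsilon> {0..<T} r u y" "y 0 = h \<epsilon> (r 0) (u 0)" "t \<in> {0..<T}" for T t r u y
      using h\<epsilon>[THEN conjunct2] that by blast
    \<comment> \<open>The self-improving estimate: from |u| < \<sigma> alone the modified system
      coincides with the effective one, invariance bounds y by C, and the energy then improves
      \<sigma> to \<open>s0\<close>.\<close>
    have confined: "norm (u t) \<le> s0 \<rho> V c0 \<and> norm (y t) \<le> C"
      if sol: "effective_solution \<rho> V \<epsilon> {0..<T} r u y" and u0: "norm (u 0) \<le> vbar"
        and y0: "y 0 = h \<epsilon> (r 0) (u 0)"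
        and u: "\<And>s. s \<in> {0..<T} \<Longrightarrow> norm (u s) < \<sigma>" and t: "t \<in> {0..<T}" for T r u y t
    proof -
      have "modified_solution \<rho> V \<delta> \<epsilon> {0..<T} r u y"
        using sol u by (subst modified_solution_iff_effective) (auto simp: \<sigma>_def intro: less_imp_le)
      then have "y s = h \<epsilon> (r s) (u s)" if "s \<in> {0..<T}" for s
        using invariant y0 that by blast
      moreover have n: "norm (u s) < 1" if "s \<in> {0..<T}" for s
        using u[OF that] \<sigma> by simp
      ultimately have y: "norm (y s) \<le> C" if "s \<in> {0..<T}" for s
        using h_bound that by simp
      have "0 \<le> C"
        using y[OF t] norm_ge_zero order_trans by blast
      then have "2 * \<epsilon> * rad_coeff \<rho> * rad_weight (\<sigma>\<^sup>2) * C \<le> 1"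
        using small[OF \<epsilon>(1,2)] by (simp add: K_def mult_ac)
      then have "Ham \<rho> V (r t) (u t) \<le> Ham \<rho> V (r 0) (u 0) + 1"
        using \<epsilon> \<sigma> t u y by (intro Ham_bound[OF sol diff]) (auto intro: less_imp_le)
      also have "\<dots> \<le> c0 + 1"
        using c0 u0 by simp
      finally show ?thesis
        using s0(2) n[OF t] y[OF t] by blast
    qed
    {
      fix T r u y
      assume *: "effective_solution \<rho> V \<epsilon> {0..<T} r u y \<and> norm (u 0) \<le> vbar \<and> y 0 = h \<epsilon> (r 0) (u 0)"
      then have sol: "effective_solution \<rho> V \<epsilon> {0..<T} r u y" by blast
      have cont: "continuous_on {0..t} u" if "t \<in> {0..<T}" for t
        by (rule continuous_on_subset[OF effective_solution_continuous[OF sol]]) (use that in auto)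
      \<comment> \<open>This is stronger than needed for the claim: the sphere of radius 1 - delta
        is not reached, on the manifold or off it.\<close>
      have "u t \<in> ball 0 \<sigma>" if "t \<in> {0..<T}" for t
      proof (rule continuation_principle[where I = "{0..<T}"])
        fix t assume t: "0 < t" "t \<in> {0..<T}" and u: "\<And>s. s \<in> {0..<t} \<Longrightarrow> u s \<in> ball 0 \<sigma>"
        have "effective_solution \<rho> V \<epsilon> {0..<t} r u y"
          using t by (intro effective_solution_subset[OF sol]) auto
        then have "norm (u s) \<le> s0 \<rho> V c0" if "s \<in> {0..<t}" for s
          using confined[of t r u y s] * u that by auto
        then have "norm (u t) \<le> s0 \<rho> V c0"
          by (rule norm_le_at_right_end[OF cont[OF t(2)] t(1)])
        then show "u t \<in> ball 0 \<sigma>"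
          using \<sigma> by simp
      qed (use that cont * \<sigma> in auto)
      then show "\<forall>t\<in>{0..<T}. \<not> (norm (u t) = 1 - \<delta> \<and> y t = h \<epsilon> (r t) (u t))"
        by (force simp: \<sigma>_def)
    }
    fix r0 u0 :: vec3
    assume u0: "norm u0 \<le> vbar"
    have y0: "norm (h \<epsilon> r0 u0) \<le> C"
      using h_bound u0 vbar by simp
    then have "0 \<le> C"
      using norm_ge_zero order_trans by blast
    \<comment> \<open>The cut-off radius for y is C + 1 rather than C, so that the a priori bound C
      lies strictly inside and the open-set continuation applies.\<close>
    then have "0 \<le> C + 1" and "\<epsilon> \<noteq> 0"
      using \<epsilon> by auto
    obtain r u y where init: "r 0 = r0" "u 0 = u0" "y 0 = h \<epsilon> r0 u0"
      and cont: "continuous_on {0..} u" "continuous_on {0..} y"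
      and sol: "\<forall>I\<subseteq>{0..}. (\<forall>t\<in>I. norm (u t) \<le> \<sigma> \<and> norm (y t) \<le> C + 1)
         \<longrightarrow> effective_solution \<rho> V \<epsilon> I r u y"
      using truncated_solution_exists[OF U charge_nz \<open>\<epsilon> \<noteq> 0\<close> \<sigma>(1,2) \<open>0 \<le> C + 1\<close>] by blast
    have cont': "continuous_on {0..b} u" "continuous_on {0..b} y" for b
      using continuous_on_subset[OF cont(1), of "{0..b}"] continuous_on_subset[OF cont(2), of "{0..b}"] by auto
    have bound: "(u t, y t) \<in> ball 0 \<sigma> \<times> ball 0 (C + 1)" if "0 \<le> t" for t
    proof (rule continuation_principle[where I = "{0..}"])
      fix t assume t: "0 < t" and uy: "\<And>s. s \<in> {0..<t} \<Longrightarrow> (u s, y s) \<in> ball 0 \<sigma> \<times> ball 0 (C + 1)"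
      have "effective_solution \<rho> V \<epsilon> {0..<t} r u y"
      proof (rule sol[rule_format])
        show "norm (u s) \<le> \<sigma> \<and> norm (y s) \<le> C + 1" if "s \<in> {0..<t}" for s
          using uy[OF that] by auto
      qed auto
      \<comment> \<open>Before leaving the open product of balls the truncated solution is a genuine
        one, so \<open>confined\<close> applies and improves both radii.\<close>
      then have "norm (u s) \<le> s0 \<rho> V c0 \<and> norm (y s) \<le> C" if "s \<in> {0..<t}" for s
        using confined[of t r u y s] init u0 uy that by auto
      then have "norm (u t) \<le> s0 \<rho> V c0" "norm (y t) \<le> C"
        using norm_le_at_right_end[OF cont'(1) t] norm_le_at_right_end[OF cont'(2) t] by blast+
      then show "(u t, y t) \<in> ball 0 \<sigma> \<times> ball 0 (C + 1)"
        using \<sigma> by simp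
    next
      show "continuous_on {0..b} (\<lambda>t. (u t, y t))" for b
        by (intro continuous_on_Pair cont')
      show "open (ball (0::vec3) \<sigma> \<times> ball (0::vec3) (C + 1))"
        by (intro open_Times open_ball)
    qed (use that init u0 y0 \<sigma> in auto)
    have "effective_solution \<rho> V \<epsilon> {0..} r u y"
    proof (rule sol[rule_format])
      show "norm (u t) \<le> \<sigma> \<and> norm (y t) \<le> C + 1" if "t \<in> {0..}" for t
        using bound[of t] that by auto
    qed auto
    then show "\<exists>r u y. effective_solution \<rho> V \<epsilon> {0..} r u y \<and> r 0 = r0 \<and> u 0 = u0 \<and> y 0 = h \<epsilon> r0 u0"
      using init by blast
  qed
qed

end
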